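(* Let $\hbar=\frac1p$ with $p$ a prime, $p\neq 2,3$. There exists a unique linearization of the projective representation $\rho_\hbar:\Gamma\to\mathrm{PGL}(\mathcal H_\hbar)$, i.e. a homomorphism $\rho_\hbar:\Gamma\to\mathrm{GL}(\mathcal H_\hbar)$ lifting it, with the property that it factors through the quotient group $\Gamma\to\Gamma_p$, that is, it is the composition of the reduction map $\Gamma\to\Gamma_p$ with a homomorphism $\bar\rho_\hbar:\Gamma_p\to\mathrm{GL}(\mathcal H_\hbar)$.
   Context: Let $\Lambda^*\simeq\mathbb Z^2$ be a lattice with a unimodular integral symplectic form $\omega$ (the lattice of characters of a two-dimensional symplectic torus of volume one), and let $\Gamma\simeq\mathrm{SL}_2(\mathbb Z)$ be the group of automorphisms of $\Lambda^*$ preserving $\omega$. Let $\Gamma_p\simeq \mathrm{SL}_2(\mathbb F_p)$ be the reduction of $\Gamma$ modulo $p$. Put $\psi:\mathbb F_p\to\mathbb C^*$, $\psi(t)=e^{2\pi i t/p}$. Let $\mathcal A_\hbar$ be the $\mathbb C$-algebra generated by symbols $s(\xi)$, $\xi\in\Lambda^*$, with relations $s(\xi+\eta)=\psi(\tfrac12\omega(\xi,\eta))s(\xi)s(\eta)$ (with $\omega$ reduced mod $p$, $\tfrac12\in\mathbb F_p$). $\Gamma$ acts on $\mathcal A_\hbar$ by algebra automorphisms $f\mapsto f^B$, $s(\xi)^B=s(B\xi)$, hence on isomorphism classes of irreducible representations by $\pi^B(f)=\pi(f^B)$. It is known that there is a unique (up to isomorphism) irreducible representation $(\pi_\hbar,\mathcal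 H_\hbar)$ of $\mathcal A_\hbar$ whose isomorphism class is fixed by $\Gamma$; it has dimension $p$. By Schur's lemma, for each $B\in\Gamma$ there is an operator $\rho_\hbar(B)$ on $\mathcal H_\hbar$, unique up to a scalar, with $\rho_\hbar(B)\pi_\hbar(f)\rho_\hbar(B)^{-1}=\pi_\hbar(f^B)$ for all $f\in\mathcal A_\hbar$; this defines the projective representation $\rho_\hbar:\Gamma\to\mathrm{PGL}(\mathcal H_\hbar)$. *)

theory Defs
  imports
    Complex_Main
    "HOL-Library.Poly_Mapping"
    "HOL-Library.Product_Plus"
    "HOL-Number_Theory.Modular_Inverse"
    "HOL-Algebra.Bij"
    "HOL-Algebra.QuotRing"
begin

section \<open>The lattice and its symplectic group\<close>

text \<open>
  The lattice is a type \<open>'l\<close> of class \<^class>\<open>ab_group_add\<close> that is isomorphic to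
  \<open>\<int> \<times> \<int>\<close>. Unimodularity means that the form induces an isomorphism of the lattice
  with its dual.
\<close>

definition rank_two_lattice :: "'l::ab_group_add itself \<Rightarrow> bool" where
  "rank_two_lattice _ \<longleftrightarrow>
     (\<exists>f :: int \<times> int \<Rightarrow> 'l. bij f \<and> (\<forall>x y. f (x + y) = f x + f y))"

definition unimodular_symplectic :: "('l::ab_group_add \<Rightarrow> 'l \<Rightarrow> int) \<Rightarrow> bool" where
  "unimodular_symplectic \<omega> \<longleftrightarrow>
     (\<forall>x y z. \<omega> (x + y) z = \<omega> x z + \<omega> y z) \<and>
     (\<forall>x y z. \<omega> x (y + z) = \<omega> x y + \<omega> x z) \<and>
     (\<forall>x. \<omega> x x = 0) \<and>
     (\<forall>\<phi> :: 'l \<Rightarrow> int. (\<forall>x y. \<phi> (x + y) = \<phi> x + \<phi> y) \<longrightarrow> (\<exists>!\<xi>. \<phi> = \<omega> \<xi>))"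

definition lattice_group :: "'l::ab_group_add monoid" where
  "lattice_group = \<lparr>carrier = UNIV, mult = (+), one = 0\<rparr>"

definition Gam :: "('l::ab_group_add \<Rightarrow> 'l \<Rightarrow> int) \<Rightarrow> ('l \<Rightarrow> 'l) monoid" where
  "Gam \<omega> = AutoGroup lattice_group
     \<lparr>carrier := {B \<in> auto lattice_group. \<forall>x y. \<omega> (B x) (B y) = \<omega> x y}\<rparr>"

definition lattice_mod :: "nat \<Rightarrow> 'l::ab_group_add set monoid" where
  "lattice_mod p =
     lattice_group Mod ((\<lambda>x. x [^]\<^bsub>lattice_group\<^esub> p) ` carrier lattice_group)"

definition reduction :: "nat \<Rightarrow> ('l::ab_group_add \<Rightarrow> 'l) \<Rightarrow> ('l set \<Rightarrow> 'l set)" where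
  "reduction p B = (\<lambda>C \<in> carrier (lattice_mod p). B ` C)"

definition Gam_mod :: "('l::ab_group_add \<Rightarrow> 'l \<Rightarrow> int) \<Rightarrow> nat \<Rightarrow> ('l set \<Rightarrow> 'l set) monoid" where
  "Gam_mod \<omega> p = AutoGroup (lattice_mod p) \<lparr>carrier := reduction p ` carrier (Gam \<omega>)\<rparr>"

section \<open>The algebra of quantum observables\<close>

text \<open>
  Words form the free monoid on the symbols, written additively because the
  convolution product of \<open>\<Rightarrow>\<^sub>0\<close> is taken over an additive monoid of keys (which need
  not be commutative). Thus \<open>'l fword \<Rightarrow>\<^sub>0 complex\<close> is the free unital algebra on
  symbols indexed by \<open>'l\<close>.
\<close>

datatype 'a fword = Word (letters: "'a list")

instantiation fword :: (type) monoid_add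
begin

definition zero_fword :: "'a fword" where
  "0 = Word []"

definition plus_fword :: "'a fword \<Rightarrow> 'a fword \<Rightarrow> 'a fword" where
  "u + v = Word (letters u @ letters v)"

instance
  by standard (simp_all add: zero_fword_def plus_fword_def)

end

definition free_alg :: "('l fword \<Rightarrow>\<^sub>0 complex) ring" where
  "free_alg = \<lparr>carrier = UNIV, mult = (*), one = 1, zero = 0, add = (+)\<rparr>"

definition free_sym :: "'l \<Rightarrow> ('l fword \<Rightarrow>\<^sub>0 complex)" where
  "free_sym \<xi> = Poly_Mapping.single (Word [\<xi>]) 1"

definition free_const :: "complex \<Rightarrow> ('l fword \<Rightarrow>\<^sub>0 complex)" where
  "free_const c = Poly_Mapping.single 0 c"

text \<open>Being \<open>p\<close>-periodic, \<open>psi p\<close> is a function on residues, given on integer representatives.\<close>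

definition psi :: "nat \<Rightarrow> int \<Rightarrow> complex" where
  "psi p t = exp (2 * of_real pi * \<i> * of_int t / of_nat p)"

text \<open>
  The relation \<open>s 0 = 1\<close> says that \<open>s 0\<close>, which by the other relations acts as an
  identity on all symbols, is the unit of the algebra. Without it the presented unital
  algebra has an extra direct factor \<open>\<complex>\<close>, on which all symbols vanish, and hence a second
  irreducible representation with invariant isomorphism class.
\<close>

definition relators :: "('l::ab_group_add \<Rightarrow> 'l \<Rightarrow> int) \<Rightarrow> nat \<Rightarrow> ('l fword \<Rightarrow>\<^sub>0 complex) set" where
  "relators \<omega> p =
     {free_sym (\<xi> + \<eta>)
        - free_const (psi p (modular_inverse (int p) 2 * \<omega> \<xi> \<eta>)) * free_sym \<xi> * free_sym \<eta>
      | \<xi> \<eta>. True} \<union> {free_sym 0 - 1}"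

definition rel_ideal :: "('l::ab_group_add \<Rightarrow> 'l \<Rightarrow> int) \<Rightarrow> nat \<Rightarrow> ('l fword \<Rightarrow>\<^sub>0 complex) set" where
  "rel_ideal \<omega> p = Idl\<^bsub>free_alg\<^esub> (relators \<omega> p)"

definition qalg :: "('l::ab_group_add \<Rightarrow> 'l \<Rightarrow> int) \<Rightarrow> nat \<Rightarrow> ('l fword \<Rightarrow>\<^sub>0 complex) set ring" where
  "qalg \<omega> p = free_alg Quot rel_ideal \<omega> p"

definition qalg_const :: "('l::ab_group_add \<Rightarrow> 'l \<Rightarrow> int) \<Rightarrow> nat \<Rightarrow> complex \<Rightarrow> ('l fword \<Rightarrow>\<^sub>0 complex) set" where
  "qalg_const \<omega> p c = rel_ideal \<omega> p +>\<^bsub>free_alg\<^esub> free_const c"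

text \<open>
  \<open>free_act B\<close> is the automorphism of the free algebra with \<open>s \<xi> \<mapsto> s (B \<xi>)\<close>. For \<open>B\<close> in
  the symplectic group it maps the ideal of relations onto itself, so that the image of a
  coset is a coset and \<open>qalg_act B\<close> is the induced automorphism of the quotient.
\<close>

definition free_act :: "('l \<Rightarrow> 'l) \<Rightarrow> ('l fword \<Rightarrow>\<^sub>0 complex) \<Rightarrow> ('l fword \<Rightarrow>\<^sub>0 complex)" where
  "free_act B f =
     (\<Sum>w \<in> Poly_Mapping.keys f. Poly_Mapping.single (map_fword B w) (Poly_Mapping.lookup f w))"

definition qalg_act :: "('l \<Rightarrow> 'l) \<Rightarrow> ('l fword \<Rightarrow>\<^sub>0 complex) set \<Rightarrow> ('l fword \<Rightarrow>\<^sub>0 complex) set" where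
  "qalg_act B f = free_act B ` f"

section \<open>Representations\<close>

text \<open>
  A complex vector space is a type \<open>'h\<close> of class \<^class>\<open>ab_group_add\<close> with a scalar
  multiplication \<open>scale\<close> satisfying \<^locale>\<open>vector_space\<close>. No dimension is prescribed.
\<close>

definition End_ring :: "(complex \<Rightarrow> 'h::ab_group_add \<Rightarrow> 'h) \<Rightarrow> ('h \<Rightarrow> 'h) ring" where
  "End_ring scale =
     \<lparr>carrier = {T. Vector_Spaces.linear scale scale T}, mult = (\<circ>), one = id,
      zero = (\<lambda>v. 0), add = (\<lambda>S T v. S v + T v)\<rparr>"

definition GL_group :: "(complex \<Rightarrow> 'h::ab_group_add \<Rightarrow> 'h) \<Rightarrow> ('h \<Rightarrow> 'h) monoid" where
  "GL_group scale =
     \<lparr>carrier = {T. Vector_Spaces.linear scale scale T \<and> bij T}, mult = (\<circ>), one = id\<rparr>"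

definition scalars :: "(complex \<Rightarrow> 'h::ab_group_add \<Rightarrow> 'h) \<Rightarrow> ('h \<Rightarrow> 'h) set" where
  "scalars scale = {scale c | c. c \<noteq> 0}"

definition PGL_group :: "(complex \<Rightarrow> 'h::ab_group_add \<Rightarrow> 'h) \<Rightarrow> ('h \<Rightarrow> 'h) set monoid" where
  "PGL_group scale = GL_group scale Mod scalars scale"

definition to_PGL :: "(complex \<Rightarrow> 'h::ab_group_add \<Rightarrow> 'h) \<Rightarrow> ('h \<Rightarrow> 'h) \<Rightarrow> ('h \<Rightarrow> 'h) set" where
  "to_PGL scale T = scalars scale #>\<^bsub>GL_group scale\<^esub> T"

definition representation ::
  "('l::ab_group_add \<Rightarrow> 'l \<Rightarrow> int) \<Rightarrow> nat \<Rightarrow> (complex \<Rightarrow> 'h::ab_group_add \<Rightarrow> 'h) \<Rightarrow>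
   (('l fword \<Rightarrow>\<^sub>0 complex) set \<Rightarrow> 'h \<Rightarrow> 'h) \<Rightarrow> bool" where
  "representation \<omega> p scale \<pi> \<longleftrightarrow>
     vector_space scale \<and>
     \<pi> \<in> ring_hom (qalg \<omega> p) (End_ring scale) \<and>
     (\<forall>c. \<pi> (qalg_const \<omega> p c) = scale c)"

definition irreducible_rep ::
  "('l::ab_group_add \<Rightarrow> 'l \<Rightarrow> int) \<Rightarrow> nat \<Rightarrow> (complex \<Rightarrow> 'h::ab_group_add \<Rightarrow> 'h) \<Rightarrow>
   (('l fword \<Rightarrow>\<^sub>0 complex) set \<Rightarrow> 'h \<Rightarrow> 'h) \<Rightarrow> bool" where
  "irreducible_rep \<omega> p scale \<pi> \<longleftrightarrow>
     representation \<omega> p scale \<pi> \<and>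
     (\<exists>v :: 'h. v \<noteq> 0) \<and>
     (\<forall>W. module.subspace scale W \<and> (\<forall>f \<in> carrier (qalg \<omega> p). \<pi> f ` W \<subseteq> W)
        \<longrightarrow> W = {0} \<or> W = UNIV)"

definition twist ::
  "('l \<Rightarrow> 'l) \<Rightarrow> (('l fword \<Rightarrow>\<^sub>0 complex) set \<Rightarrow> 'h \<Rightarrow> 'h) \<Rightarrow>
   (('l fword \<Rightarrow>\<^sub>0 complex) set \<Rightarrow> 'h \<Rightarrow> 'h)" where
  "twist B \<pi> = (\<lambda>f. \<pi> (qalg_act B f))"

text \<open>Isomorphism of two representations on the same space, which is the case of \<open>\<pi>\<close> and its twists.\<close>

definition rep_iso ::
  "('l::ab_group_add \<Rightarrow> 'l \<Rightarrow> int) \<Rightarrow> nat \<Rightarrow> (complex \<Rightarrow> 'h::ab_group_add \<Rightarrow> 'h) \<Rightarrow>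
   (('l fword \<Rightarrow>\<^sub>0 complex) set \<Rightarrow> 'h \<Rightarrow> 'h) \<Rightarrow>
   (('l fword \<Rightarrow>\<^sub>0 complex) set \<Rightarrow> 'h \<Rightarrow> 'h) \<Rightarrow> bool" where
  "rep_iso \<omega> p scale \<pi>\<^sub>1 \<pi>\<^sub>2 \<longleftrightarrow>
     (\<exists>T \<in> carrier (GL_group scale). \<forall>f \<in> carrier (qalg \<omega> p). T \<circ> \<pi>\<^sub>1 f = \<pi>\<^sub>2 f \<circ> T)"

definition Gam_invariant ::
  "('l::ab_group_add \<Rightarrow> 'l \<Rightarrow> int) \<Rightarrow> nat \<Rightarrow> (complex \<Rightarrow> 'h::ab_group_add \<Rightarrow> 'h) \<Rightarrow>
   (('l fword \<Rightarrow>\<^sub>0 complex) set \<Rightarrow> 'h \<Rightarrow> 'h) \<Rightarrow> bool" where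
  "Gam_invariant \<omega> p scale \<pi> \<longleftrightarrow>
     (\<forall>B \<in> carrier (Gam \<omega>). rep_iso \<omega> p scale (twist B \<pi>) \<pi>)"

text \<open>
  The set of all invertible \<open>T\<close> with \<open>T \<pi>(f) T\<^sup>-\<^sup>1 = \<pi>(f\<^sup>B)\<close>. For an irreducible \<open>\<pi>\<close> with
  invariant isomorphism class it is, by Schur's lemma, a single coset of the scalars, that
  is, an element of \<open>PGL_group scale\<close>.
\<close>

definition proj_rep ::
  "('l::ab_group_add \<Rightarrow> 'l \<Rightarrow> int) \<Rightarrow> nat \<Rightarrow> (complex \<Rightarrow> 'h::ab_group_add \<Rightarrow> 'h) \<Rightarrow>
   (('l fword \<Rightarrow>\<^sub>0 complex) set \<Rightarrow> 'h \<Rightarrow> 'h) \<Rightarrow> ('l \<Rightarrow> 'l) \<Rightarrow> ('h \<Rightarrow> 'h) set" where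
  "proj_rep \<omega> p scale \<pi> B =
     {T \<in> carrier (GL_group scale). \<forall>f \<in> carrier (qalg \<omega> p).
        T \<circ> \<pi> f \<circ> inv_into UNIV T = \<pi> (qalg_act B f)}"

text \<open>
  Extensionality only fixes the values of the function outside the group, so that
  uniqueness is meaningful.
\<close>

definition linearization ::
  "('l::ab_group_add \<Rightarrow> 'l \<Rightarrow> int) \<Rightarrow> nat \<Rightarrow> (complex \<Rightarrow> 'h::ab_group_add \<Rightarrow> 'h) \<Rightarrow>
   (('l fword \<Rightarrow>\<^sub>0 complex) set \<Rightarrow> 'h \<Rightarrow> 'h) \<Rightarrow> (('l \<Rightarrow> 'l) \<Rightarrow> 'h \<Rightarrow> 'h) \<Rightarrow> bool" where
  "linearization \<omega> p scale \<pi> \<rho> \<longleftrightarrow>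
     \<rho> \<in> hom (Gam \<omega>) (GL_group scale) \<inter> extensional (carrier (Gam \<omega>)) \<and>
     (\<forall>B \<in> carrier (Gam \<omega>). to_PGL scale (\<rho> B) = proj_rep \<omega> p scale \<pi> B)"

end

theory Submission
  imports Defs
    "Jordan_Normal_Form.Determinant"
    "HOL-Computational_Algebra.Fundamental_Theorem_Algebra"
    "HOL-Analysis.Continuum_Not_Denumerable"
begin

text \<open>
  By Dixmier's form of Schur's lemma the elements \<open>s \<xi>\<close> with \<open>\<xi> \<in> p \<Lambda>\<close> act by scalars, which
  are \<open>1\<close> by \<open>\<Gamma>\<close>-invariance. Hence the representation is the \<open>p\<close>-dimensional Heisenberg
  representation, and the operators attached to \<open>B \<in> \<Gamma>\<close> only depend on \<open>B\<close> modulo \<open>p\<close>.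
  The operator attached to \<open>-1\<close> splits the space into an even part of dimension
  \<open>(p + 1) / 2\<close> and an odd part of dimension \<open>(p - 1) / 2\<close>, and both are preserved by every
  operator \<open>T\<close> attached to an element of \<open>\<Gamma>\<close>. The quotient \<open>\<nu> T\<close> of the determinants of \<open>T\<close> on
  the two parts is multiplicative and satisfies \<open>\<nu> (c T) = c \<nu> T\<close>, so the condition \<open>\<nu> T = 1\<close>
  selects one operator from each projective class, and these form a group. Two
  linearizations differ by a character of \<open>SL\<^sub>2(\<int>)\<close> that factors through reduction modulo \<open>p\<close>;
  its value on a shear is killed by \<open>p\<close> and by \<open>12\<close>, hence trivial.
\<close>

section \<open>Linear algebra in countable dimension\<close>

text \<open>Since no dimension is prescribed, Schur's lemma has to rest on the countability of the
  lattice, and finite dimension only comes out as a consequence. The determinant on the whole space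
  scales by \<open>c ^ p\<close> and would leave a p-th root of unity undecided; two invariant parts
  whose dimensions differ by one turn this factor into \<open>c\<close> itself, so no root is
  extracted and no cocycle is computed. The normalization refers to the operator T alone, and the
  candidates for B see B only through the operators \<open>R (B z)\<close>, which are p-periodic in
  \<open>B z\<close>. Hence the lift depends on B modulo p by construction, without a presentation
  of the finite group. The number 12 arises because the rotation of order 4 is a product of three
  shears on which any character takes one and the same value. Odd p provides the half modulo p and
  the unequal parity spaces; coprimality with 3 enters through the 12.\<close>

context vector_space
begin

text \<open>A finite subset of S spans a space that contains only finitely many vectors of B, and a
  countable S has only countably many finite subsets.\<close>

lemma countable_independent:
  assumes "countable S" "independent B" "B \<subseteq> span S"
  shows "countable B"
proof -
  have "B \<subseteq> (\<Union>F\<in>{F. F \<subseteq> S \<and> finite F}. B \<inter> span F)"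
  proof
    fix b assume "b \<in> B"
    then have "b \<in> span S" using assms(3) by blast
    then obtain F a where "finite F" "F \<subseteq> S" "b = (\<Sum>v\<in>F. a v *s v)"
      unfolding span_explicit by blast
    then have "b \<in> span F" by (auto intro: span_sum span_scale span_base)
    then show "b \<in> (\<Union>F\<in>{F. F \<subseteq> S \<and> finite F}. B \<inter> span F)"
      using \<open>b \<in> B\<close> \<open>finite F\<close> \<open>F \<subseteq> S\<close> by blast
  qed
  moreover have "countable (\<Union>F\<in>{F. F \<subseteq> S \<and> finite F}. B \<inter> span F)"
  proof (rule countable_UN)
    have "countable {F. finite F \<and> F \<subseteq> S}"
      using assms(1) by (rule countable_Collect_finite_subset)
    then show "countable {F. F \<subseteq> S \<and> finite F}"
      by (simp add: conj_commute)
    fix F assume "F \<in> {F. F \<subseteq> S \<and> finite F}"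
    moreover have "independent (B \<inter> span F)"
      using assms(2) by (rule independent_mono) simp
    ultimately have "finite (B \<inter> span F)"
      using independent_span_bound[of F "B \<inter> span F"] by simp
    then show "countable (B \<inter> span F)" by (rule countable_finite)
  qed
  ultimately show ?thesis by (rule countable_subset)
qed

end

locale complex_vector_space = vector_space scale
  for scale :: "complex \<Rightarrow> 'h::ab_group_add \<Rightarrow> 'h" (infixr \<open>*s\<close> 75)
begin

text \<open>The coefficients are indexed by I rather than by vectors, so the assumption also
  excludes repetitions: equal values would give a relation with coefficients 1 and -1. Used for the
  resolvent vectors and for the states.\<close>

lemma independent_family:
  assumes "\<And>C a c. finite C \<Longrightarrow> C \<subseteq> I \<Longrightarrow> (\<Sum>i\<in>C. a i *s f i) = 0 \<Longrightarrow> c \<in> C \<Longrightarrow> a c = 0"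
  shows "inj_on f I" "independent (f ` I)"
proof -
  show inj: "inj_on f I"
  proof (rule inj_onI, rule ccontr)
    fix x y assume "x \<in> I" "y \<in> I" "f x = f y" "x \<noteq> y"
    then show False using assms[of "{x, y}" "\<lambda>c. if c = x then 1 else -1" x] by simp
  qed
  show "independent (f ` I)"
    unfolding independent_explicit_module
  proof (intro allI impI)
    fix t u w assume t: "finite t" "t \<subseteq> f ` I" "(\<Sum>v\<in>t. u v *s v) = 0" "w \<in> t"
    then obtain C where C: "C \<subseteq> I" "t = f ` C" "finite C" by (meson finite_subset_image)
    obtain c where "w = f c" "c \<in> C" using t C by blast
    moreover have "(\<Sum>c\<in>C. u (f c) *s f c) = 0"
      using t(3) unfolding C by (subst (asm) sum.reindex) (auto intro: inj_on_subset[OF inj C(1)])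
    ultimately show "u w = 0" using assms[OF C(3,1), of "\<lambda>c. u (f c)" c] by simp
  qed
qed

section \<open>Polynomials in an operator\<close>

definition poly_act :: "('h \<Rightarrow> 'h) \<Rightarrow> complex poly \<Rightarrow> 'h \<Rightarrow> 'h" where
  "poly_act T q v = (\<Sum>i\<le>degree q. coeff q i *s (T ^^ i) v)"

lemma poly_act_bound:
  assumes "degree q \<le> n"
  shows "poly_act T q v = (\<Sum>i\<le>n. coeff q i *s (T ^^ i) v)"
  unfolding poly_act_def
  by (rule sum.mono_neutral_left) (use assms in \<open>auto simp: coeff_eq_0\<close>)

lemma poly_act_0 [simp]: "poly_act T 0 v = 0"
  by (simp add: poly_act_def)

lemma poly_act_add: "poly_act T (q + r) v = poly_act T q v + poly_act T r v"
proof -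
  let ?n = "max (degree q) (degree r)"
  have "poly_act T (q + r) v = (\<Sum>i\<le>?n. coeff (q + r) i *s (T ^^ i) v)"
    by (rule poly_act_bound) (rule degree_add_le_max)
  also have "\<dots> = poly_act T q v + poly_act T r v"
    by (simp add: poly_act_bound[of q ?n] poly_act_bound[of r ?n] scale_left_distrib sum.distrib)
  finally show ?thesis .
qed

lemma poly_act_smult: "poly_act T (smult a q) v = a *s poly_act T q v"
  by (simp add: poly_act_bound[of "smult a q" "degree q"] degree_smult_le poly_act_def scale_sum_right)

lemma poly_act_sum: "poly_act T (\<Sum>x\<in>A. g x) v = (\<Sum>x\<in>A. poly_act T (g x) v)"
  by (induction A rule: infinite_finite_induct) (simp_all add: poly_act_add)

lemma poly_act_pCons:
  assumes "Vector_Spaces.linear scale scale T"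
  shows "poly_act T (pCons a q) v = a *s v + T (poly_act T q v)"
    and "poly_act T (pCons a q) v = a *s v + poly_act T q (T v)"
proof -
  interpret T: Vector_Spaces.linear scale scale T by fact
  have *: "poly_act T (pCons a q) v = a *s v + (\<Sum>i\<le>degree q. coeff q i *s (T ^^ Suc i) v)"
    by (subst poly_act_bound[of _ "Suc (degree q)"])
      (simp_all add: degree_pCons_le sum.atMost_Suc_shift del: funpow.simps sum.atMost_Suc)
  show "poly_act T (pCons a q) v = a *s v + T (poly_act T q v)"
    unfolding * by (simp add: poly_act_def T.sum T.scale)
  show "poly_act T (pCons a q) v = a *s v + poly_act T q (T v)"
    unfolding * by (simp add: poly_act_def funpow_swap1)
qed

lemma linear_poly_act:
  assumes "Vector_Spaces.linear scale scale T"
  shows "Vector_Spaces.linear scale scale (poly_act T q)"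
proof -
  interpret T: Vector_Spaces.linear scale scale T by fact
  have pow: "(T ^^ i) (u + v) = (T ^^ i) u + (T ^^ i) v" "(T ^^ i) (c *s v) = c *s (T ^^ i) v" for i u v c
    by (induction i) (simp_all add: T.add T.scale)
  show ?thesis
    by unfold_locales
      (simp_all add: poly_act_def pow scale_right_distrib sum.distrib scale_sum_right mult.commute)
qed

text \<open>The factor T - c may stand on either side of q(T). On the left it is cancelled by
  injectivity; on the right it is absorbed by a vector
  \<open>(T - c)\<^sup>-\<^sup>1 v\<close>.\<close>

lemma poly_act_linear_factor:
  assumes "Vector_Spaces.linear scale scale T"
  shows "poly_act T ([:- c, 1:] * q) v = T (poly_act T q v) - c *s poly_act T q v"
    and "poly_act T ([:- c, 1:] * q) v = poly_act T q (T v - c *s v)"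
proof -
  interpret A: Vector_Spaces.linear scale scale "poly_act T q" by (rule linear_poly_act) fact
  show "poly_act T ([:- c, 1:] * q) v = T (poly_act T q v) - c *s poly_act T q v"
    using poly_act_add[of T "pCons 0 q" "smult (- c) q" v] poly_act_smult[of T "- c" q v]
    by (simp add: poly_act_pCons(1)[OF assms])
  show "poly_act T ([:- c, 1:] * q) v = poly_act T q (T v - c *s v)"
    using poly_act_add[of T "pCons 0 q" "smult (- c) q" v] poly_act_smult[of T "- c" q v]
    by (simp add: poly_act_pCons(2)[OF assms] A.diff A.scale)
qed

text \<open>Over the complex numbers q splits into linear factors, and each factor T - c is
  injective by assumption.\<close>

lemma poly_act_inj:
  assumes T: "Vector_Spaces.linear scale scale T"
    and inj: "\<And>c v. T v - c *s v = 0 \<Longrightarrow> v = 0"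
    and "q \<noteq> 0" "poly_act T q v = 0"
  shows "v = 0"
  using assms(3,4)
proof (induction "degree q" arbitrary: q)
  case 0
  then obtain a where "q = [:a:]" by (metis degree_eq_zeroE)
  then show ?case using 0 by (simp add: poly_act_def)
next
  case (Suc n)
  have "\<not> constant (poly q)" using Suc.hyps(2) by (simp add: constant_degree)
  then obtain c where "poly q c = 0" using fundamental_theorem_of_algebra by blast
  then obtain r where r: "q = [:- c, 1:] * r" by (metis poly_eq_0_iff_dvd dvdE)
  then have "r \<noteq> 0" using Suc.prems by auto
  then have "degree q = Suc (degree r)" unfolding r by (subst degree_mult_eq) auto
  moreover have "poly_act T r v = 0"
    using Suc.prems(2) inj unfolding r poly_act_linear_factor(1)[OF T] by blast
  ultimately show ?case using Suc \<open>r \<noteq> 0\<close> by simp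
qed

text \<open>
  Dixmier's argument: an operator without eigenvalue whose translates by scalars are all
  invertible produces uncountably many linearly independent vectors \<open>(T - c)\<^sup>-\<^sup>1 v\<close>.
\<close>

lemma scalar_of_countable_span:
  assumes T: "Vector_Spaces.linear scale scale T"
    and dich: "\<And>c. T = scale c \<or> bij (\<lambda>v. T v - c *s v)"
    and S: "countable S" "span S = UNIV" and v: "v \<noteq> (0::'h)"
  shows "\<exists>c. T = scale c"
proof (rule ccontr)
  assume neg: "\<nexists>c. T = scale c"
  interpret T: Vector_Spaces.linear scale scale T by fact
  have bij: "bij (\<lambda>v. T v - c *s v)" for c using neg dich by blast
  have inj: "w = 0" if "T w - c *s w = 0" for c w
    using injD[OF bij_is_inj[OF bij[of c]], of w 0] that T.zero by simp
  define r where "r c = inv_into UNIV (\<lambda>v. T v - c *s v) v" for c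
  have r: "T (r c) - c *s r c = v" for c
    unfolding r_def using surj_f_inv_f[OF bij_is_surj[OF bij[of c]], of v] .
  have key: "a c0 = 0" if C: "finite C" "(\<Sum>c\<in>C. a c *s r c) = 0" "c0 \<in> C" for C a c0
  proof -
    \<comment> \<open>Clearing denominators: applying the product of all T - d, d in C, to the
      relation among the resolvent vectors leaves a polynomial Q in T applied to v.\<close>
    define M where "M D = (\<Prod>d\<in>D. [:- d, 1:])" for D :: "complex set"
    define Q where "Q = (\<Sum>c\<in>C. smult (a c) (M (C - {c})))"
    have M: "M C = [:- c, 1:] * M (C - {c})" if "c \<in> C" for c
      unfolding M_def using C(1) that by (rule prod.remove)
    interpret A: Vector_Spaces.linear scale scale "poly_act T (M C)"
      by (rule linear_poly_act) fact
    have "0 = poly_act T (M C) (\<Sum>c\<in>C. a c *s r c)" using C(2) A.zero by simp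
    also have "\<dots> = (\<Sum>c\<in>C. a c *s poly_act T (M (C - {c})) v)"
      unfolding A.sum A.scale
    proof (rule sum.cong)
      fix c assume "c \<in> C"
      then show "a c *s poly_act T (M C) (r c) = a c *s poly_act T (M (C - {c})) v"
        by (simp only: M poly_act_linear_factor(2)[OF T] r)
    qed simp
    also have "\<dots> = poly_act T Q v"
      by (simp add: Q_def poly_act_sum poly_act_smult)
    finally have Q: "0 = poly_act T Q v" .
    have "Q = 0" using poly_act_inj[OF T _ _ Q[symmetric]] inj v by blast
    \<comment> \<open>Evaluation at c0 as in Lagrange interpolation: every other summand contains
      the factor that vanishes at c0.\<close>
    then have "0 = (\<Sum>c\<in>C. a c * poly (M (C - {c})) c0)"
      by (metis (mono_tags, lifting) Q_def poly_0 poly_smult poly_sum sum.cong)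
    also have "\<dots> = (\<Sum>c\<in>C. if c = c0 then a c0 * poly (M (C - {c0})) c0 else 0)"
      using C(1,3) by (intro sum.cong) (auto simp: M_def poly_prod)
    also have "\<dots> = a c0 * poly (M (C - {c0})) c0"
      using C by simp
    finally show ?thesis
      using C(1) by (auto simp: M_def poly_prod)
  qed
  have "inj r" "independent (range r)"
    using independent_family[of UNIV r] key by blast+
  then have "countable (range r)" using countable_independent[OF S(1)] S(2) by simp
  then have "countable (UNIV :: complex set)" using \<open>inj r\<close> by (simp add: countable_image_inj_eq)
  then show False using uncountable_UNIV_complex by simp
qed

text \<open>A list, because a matrix needs an order of the basis. Vectors outside the span get the
  coordinates 0 from \<open>representation\<close>, whence the stability assumptions in the lemmas
  on products and multiples.\<close>

definition mat_on :: "'h list \<Rightarrow> ('h \<Rightarrow> 'h) \<Rightarrow> complex mat" where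
  "mat_on bs T = mat (length bs) (length bs)
     (\<lambda>(i, j). representation (set bs) (T (bs ! j)) (bs ! i))"

lemma mat_on_carrier [simp]: "mat_on bs T \<in> carrier_mat (length bs) (length bs)"
  by (simp add: mat_on_def)

lemma mat_on_scale:
  assumes "independent (set bs)" "T ` set bs \<subseteq> span (set bs)"
  shows "mat_on bs (\<lambda>v. c *s T v) = c \<cdot>\<^sub>m mat_on bs T"
  by (rule eq_matI) (use assms in \<open>auto simp: mat_on_def representation_scale image_subset_iff\<close>)

lemma mat_on_ident:
  assumes "independent (set bs)" "distinct bs"
  shows "mat_on bs (\<lambda>v. v) = 1\<^sub>m (length bs)"
  by (rule eq_matI)
    (use assms in \<open>auto simp: mat_on_def representation_basis nth_eq_iff_index_eq\<close>)

lemma mat_on_compose: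
  assumes bs: "independent (set bs)" "distinct bs"
    and S: "Vector_Spaces.linear scale scale S" "S ` set bs \<subseteq> span (set bs)"
    and T: "T ` set bs \<subseteq> span (set bs)"
  shows "mat_on bs (\<lambda>v. S (T v)) = mat_on bs S * mat_on bs T"
proof (rule eq_matI)
  interpret S: Vector_Spaces.linear scale scale S by fact
  let ?rep = "\<lambda>v. representation (set bs) v" and ?n = "length bs"
  fix i j assume "i < dim_row (mat_on bs S * mat_on bs T)" "j < dim_col (mat_on bs S * mat_on bs T)"
  then have ij: "i < ?n" "j < ?n" by (simp_all add: mat_on_def)
  have "T (bs ! j) = (\<Sum>b\<in>set bs. ?rep (T (bs ! j)) b *s b)"
    by (rule sum_representation_eq[symmetric]) (use bs T ij in auto)
  then have "S (T (bs ! j)) = S (\<Sum>b\<in>set bs. ?rep (T (bs ! j)) b *s b)" by simp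
  also have "\<dots> = (\<Sum>b\<in>set bs. ?rep (T (bs ! j)) b *s S b)"
    by (simp add: S.sum S.scale)
  finally have "?rep (S (T (bs ! j))) (bs ! i) = (\<Sum>b\<in>set bs. ?rep (T (bs ! j)) b * ?rep (S b) (bs ! i))"
    using bs S(2) by (simp add: representation_sum representation_scale span_scale image_subset_iff)
  also have "\<dots> = (\<Sum>k<?n. ?rep (T (bs ! j)) (bs ! k) * ?rep (S (bs ! k)) (bs ! i))"
    by (rule sum.reindex_bij_betw[symmetric]) (use bs(2) in \<open>auto intro: bij_betw_nth\<close>)
  also have "\<dots> = (mat_on bs S * mat_on bs T) $$ (i, j)"
    using ij by (simp add: mat_on_def scalar_prod_def mult.commute lessThan_atLeast0)
  finally show "mat_on bs (\<lambda>v. S (T v)) $$ (i, j) = (mat_on bs S * mat_on bs T) $$ (i, j)"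
    using ij by (simp add: mat_on_def)
qed (simp_all add: mat_on_def)

lemma det_mat_on_compose:
  assumes "independent (set bs)" "distinct bs"
    and "Vector_Spaces.linear scale scale S" "S ` set bs \<subseteq> span (set bs)" "T ` set bs \<subseteq> span (set bs)"
  shows "det (mat_on bs (\<lambda>v. S (T v))) = det (mat_on bs S) * det (mat_on bs T)"
  by (simp add: mat_on_compose[OF assms] det_mult[of _ "length bs"])

lemma det_mat_on_scale:
  assumes "independent (set bs)" "T ` set bs \<subseteq> span (set bs)"
  shows "det (mat_on bs (\<lambda>v. c *s T v)) = c ^ length bs * det (mat_on bs T)"
  using assms by (simp add: mat_on_scale) (simp add: mat_on_def)

end

section \<open>The algebra of quantum observables\<close>

lemma poly_mapping_additive_induct:
  fixes f :: "'k \<Rightarrow>\<^sub>0 'v::comm_monoid_add"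
  assumes "P 0" "\<And>f g. P f \<Longrightarrow> P g \<Longrightarrow> P (f + g)" "\<And>k v. P (Poly_Mapping.single k v)"
  shows "P f"
proof -
  have "P (\<Sum>k\<in>K. Poly_Mapping.single k (Poly_Mapping.lookup f k))" for K
    by (induction K rule: infinite_finite_induct) (use assms in auto)
  moreover have "f = (\<Sum>k\<in>Poly_Mapping.keys f. Poly_Mapping.single k (Poly_Mapping.lookup f k))"
    by (rule poly_mapping_eqI) (simp add: lookup_sum lookup_single when_def in_keys_iff)
  ultimately show ?thesis by metis
qed

lemma single_fword_Cons:
  "Poly_Mapping.single (Word (x # xs)) c = free_sym x * Poly_Mapping.single (Word xs) (c::complex)"
  by (simp add: free_sym_def mult_single plus_fword_def)

lemma single_fword_Nil: "Poly_Mapping.single (Word []) c = free_const c"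
  by (simp add: free_const_def zero_fword_def)

text \<open>Every word is a product of symbols, obtained by peeling off letters. This is what
  reduces statements about representations to the operators of the symbols.\<close>

lemma free_alg_induct:
  assumes const: "\<And>c. P (free_const c)" and sym: "\<And>x. P (free_sym x)"
    and add: "\<And>f g. P f \<Longrightarrow> P g \<Longrightarrow> P (f + g)" and mult: "\<And>f g. P f \<Longrightarrow> P g \<Longrightarrow> P (f * g)"
  shows "P f"
proof (induction f rule: poly_mapping_additive_induct)
  case 1
  then show ?case using const[of 0] by (simp add: free_const_def)
next
  case (3 w c)
  have "P (Poly_Mapping.single (Word xs) c)" for xs
    by (induction xs) (simp_all add: single_fword_Cons single_fword_Nil const sym mult)
  then show ?case by (cases w) simp
qed (rule add)

text \<open>The support of a sum may be smaller than the union of the supports; additivity needs one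
  index set common to all three terms.\<close>

lemma free_act_bound:
  assumes "finite K" "Poly_Mapping.keys f \<subseteq> K"
  shows "free_act B f = (\<Sum>w\<in>K. Poly_Mapping.single (map_fword B w) (Poly_Mapping.lookup f w))"
  unfolding free_act_def
  by (rule sum.mono_neutral_left) (use assms in \<open>auto simp: in_keys_iff\<close>)

lemma free_act_single [simp]:
  "free_act B (Poly_Mapping.single w c) = Poly_Mapping.single (map_fword B w) c"
  by (subst free_act_bound[of "{w}"]) auto

lemma free_act_add: "free_act B (f + g) = free_act B f + free_act B g"
proof -
  let ?K = "Poly_Mapping.keys f \<union> Poly_Mapping.keys g"
  show ?thesis
    by (simp add: free_act_bound[of ?K] Poly_Mapping.keys_add lookup_add single_add sum.distrib)
qed

lemma free_act_0 [simp]: "free_act B 0 = 0"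
  by (simp add: free_act_def)

lemma free_act_sym [simp]: "free_act B (free_sym x) = free_sym (B x)"
  by (simp add: free_sym_def)

lemma free_act_const [simp]: "free_act B (free_const c) = free_const c"
  by (simp add: free_const_def zero_fword_def)

lemma free_act_1 [simp]: "free_act B 1 = 1"
  using free_act_const[of B 1] by (simp add: free_const_def)

lemma free_act_uminus: "free_act B (- f) = - free_act B f"
  using free_act_add[of B f "- f"] by (simp add: eq_neg_iff_add_eq_0 add.commute)

lemma free_act_diff: "free_act B (f - g) = free_act B f - free_act B g"
  using free_act_add[of B f "- g"] by (simp add: free_act_uminus)

lemma map_fword_plus: "map_fword B (u + w) = map_fword B u + map_fword B w"
  by (cases u; cases w) (simp add: plus_fword_def)

lemma free_act_mult: "free_act B (f * g) = free_act B f * free_act B g"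
proof (induction f rule: poly_mapping_additive_induct)
  case (3 w c)
  show ?case
  proof (induction g rule: poly_mapping_additive_induct)
    case (3 w' c')
    then show ?case by (simp add: mult_single map_fword_plus)
  qed (simp_all add: distrib_left free_act_add)
qed (simp_all add: distrib_right free_act_add)

lemma free_act_compose: "free_act A (free_act B f) = free_act (A \<circ> B) f"
  by (induction f rule: poly_mapping_additive_induct)
    (simp_all add: free_act_add fword.map_comp comp_def)

lemma free_act_id: "free_act id f = f"
  by (induction f rule: poly_mapping_additive_induct)
    (simp_all add: free_act_add fword.map_id[unfolded id_def] id_def)

section \<open>The ideal of relations and the quotient algebra\<close>

lemma free_alg_simps [simp]:
  "carrier free_alg = UNIV" "mult free_alg = (*)" "one free_alg = 1" "zero free_alg = 0" "add free_alg = (+)"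
  by (simp_all add: free_alg_def)

lemma ring_free_alg: "ring (free_alg :: ('a fword \<Rightarrow>\<^sub>0 complex) ring)"
proof (rule ringI)
  show "abelian_group (free_alg :: ('a fword \<Rightarrow>\<^sub>0 complex) ring)"
  proof (rule abelian_groupI)
    fix x :: "'a fword \<Rightarrow>\<^sub>0 complex"
    show "\<exists>y\<in>carrier free_alg. y \<oplus>\<^bsub>free_alg\<^esub> x = \<zero>\<^bsub>free_alg\<^esub>"
      by (rule bexI[of _ "- x"]) simp_all
  qed (simp_all add: ac_simps)
  show "monoid (free_alg :: ('a fword \<Rightarrow>\<^sub>0 complex) ring)"
    by (rule monoidI) (simp_all add: ac_simps)
qed (simp_all add: ring_distribs)

lemma ideal_rel_ideal: "ideal (rel_ideal \<omega> p) free_alg"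
  unfolding rel_ideal_def by (rule ring.genideal_ideal[OF ring_free_alg]) simp

text \<open>The carrier of \<open>Gam\<close> in terms of plain functions. It is used for the
  lattice form and again, in coordinates, for \<open>area\<close>.\<close>

definition symplectic :: "('l::ab_group_add \<Rightarrow> 'l \<Rightarrow> int) \<Rightarrow> ('l \<Rightarrow> 'l) set" where
  "symplectic \<omega> = {B. bij B \<and> (\<forall>x y. B (x + y) = B x + B y) \<and> (\<forall>x y. \<omega> (B x) (B y) = \<omega> x y)}"

lemma carrier_Gam: "carrier (Gam \<omega>) = symplectic \<omega>"
  by (auto simp: Gam_def AutoGroup_def auto_def lattice_group_def symplectic_def hom_def Bij_def extensional_def)

lemma symplecticD:
  assumes "B \<in> symplectic \<omega>"
  shows "bij B" "B (x + y) = B x + B y" "\<omega> (B x) (B y) = \<omega> x y"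
  using assms by (auto simp: symplectic_def)

lemma symplectic_inv:
  assumes "B \<in> symplectic \<omega>" shows "inv_into UNIV B \<in> symplectic \<omega>"
proof -
  note B = symplecticD[OF assms]
  have i: "inv_into UNIV B (B x) = x" "B (inv_into UNIV B x) = x" for x
    using B(1) by (simp_all add: bij_is_inj bij_is_surj surj_f_inv_f)
  have "inv_into UNIV B (x + y) = inv_into UNIV B x + inv_into UNIV B y" for x y
    by (metis B(2) i)
  moreover have "\<omega> (inv_into UNIV B x) (inv_into UNIV B y) = \<omega> x y" for x y
    by (metis B(3) i(2))
  ultimately show ?thesis using B(1) by (simp add: symplectic_def bij_imp_bij_inv)
qed

text \<open>The preimage of the ideal is an ideal, and it contains the relators because B carries
  relators to relators; minimality gives one inclusion. The same inclusion for the inverse of B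
  gives the other.\<close>

lemma free_act_rel_ideal:
  assumes "B \<in> symplectic \<omega>"
  shows "free_act B ` rel_ideal \<omega> p = rel_ideal \<omega> p"
proof -
  have sub: "free_act B f \<in> rel_ideal \<omega> p" if B: "B \<in> symplectic \<omega>" and f: "f \<in> rel_ideal \<omega> p" for B f
  proof -
    interpret I: ideal "rel_ideal \<omega> p" free_alg by (rule ideal_rel_ideal)
    have zero: "B 0 = 0" using symplecticD(2)[OF B, of 0 0] by simp
    have "ideal {f. free_act B f \<in> rel_ideal \<omega> p} free_alg"
    proof (rule idealI[OF ring_free_alg])
      show "subgroup {f. free_act B f \<in> rel_ideal \<omega> p} (add_monoid free_alg)"
      proof (rule group.subgroupI)
        show "group (add_monoid free_alg)"
          by (rule abelian_group.a_group[OF ring.is_abelian_group[OF ring_free_alg]])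
        show "{f. free_act B f \<in> rel_ideal \<omega> p} \<noteq> {}"
          using additive_subgroup.zero_closed[OF I.additive_subgroup_axioms] by (auto intro!: exI[of _ 0])
        fix a :: "'a fword \<Rightarrow>\<^sub>0 complex"
        assume a: "a \<in> {f. free_act B f \<in> rel_ideal \<omega> p}"
        have "inv\<^bsub>add_monoid free_alg\<^esub> a = - a"
          using abelian_group.minus_equality[OF ring.is_abelian_group[OF ring_free_alg], of "- a" a]
          by (simp add: a_inv_def)
        moreover have "- free_act B a = \<ominus>\<^bsub>free_alg\<^esub> free_act B a"
          using abelian_group.minus_equality[OF ring.is_abelian_group[OF ring_free_alg], of "- free_act B a" "free_act B a"]
          by simp
        moreover have "\<ominus>\<^bsub>free_alg\<^esub> free_act B a \<in> rel_ideal \<omega> p"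
          using a by (simp add: additive_subgroup.a_inv_closed[OF I.additive_subgroup_axioms])
        ultimately show "inv\<^bsub>add_monoid free_alg\<^esub> a \<in> {f. free_act B f \<in> rel_ideal \<omega> p}"
          by (simp add: free_act_uminus)
      next
        fix a b :: "'a fword \<Rightarrow>\<^sub>0 complex"
        assume "a \<in> {f. free_act B f \<in> rel_ideal \<omega> p}" "b \<in> {f. free_act B f \<in> rel_ideal \<omega> p}"
        then show "a \<otimes>\<^bsub>add_monoid free_alg\<^esub> b \<in> {f. free_act B f \<in> rel_ideal \<omega> p}"
          using additive_subgroup.a_closed[OF I.additive_subgroup_axioms] by (simp add: free_act_add)
      qed simp
    qed (use I.I_l_closed I.I_r_closed in \<open>simp_all add: free_act_mult\<close>)
    moreover have "relators \<omega> p \<subseteq> {f. free_act B f \<in> rel_ideal \<omega> p}"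
    proof
      fix r assume r: "r \<in> relators \<omega> p"
      let ?rel = "\<lambda>\<xi> \<eta>. free_sym (\<xi> + \<eta>) -
        free_const (psi p (modular_inverse (int p) 2 * \<omega> \<xi> \<eta>)) * free_sym \<xi> * free_sym \<eta>"
      have "free_act B r \<in> relators \<omega> p"
      proof -
        consider "r = free_sym 0 - 1" | \<xi> \<eta> where "r = ?rel \<xi> \<eta>"
          using r unfolding relators_def by blast
        then show ?thesis
        proof cases
          case 1
          then show ?thesis by (simp add: relators_def free_act_diff zero)
        next
          case 2
          then have "free_act B r = ?rel (B \<xi>) (B \<eta>)"
            by (simp add: free_act_diff free_act_mult symplecticD[OF B])
          then show ?thesis unfolding relators_def by blast
        qed
      qed
      then show "r \<in> {f. free_act B f \<in> rel_ideal \<omega> p}"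
        using ring.genideal_self[OF ring_free_alg, of "relators \<omega> p"] unfolding rel_ideal_def by auto
    qed
    ultimately have "rel_ideal \<omega> p \<subseteq> {f. free_act B f \<in> rel_ideal \<omega> p}"
      unfolding rel_ideal_def by (rule ring.genideal_minimal[OF ring_free_alg])
    then show ?thesis using f by blast
  qed
  show ?thesis
  proof (intro equalityI subsetI)
    fix f assume f: "f \<in> rel_ideal \<omega> p"
    have "f = free_act B (free_act (inv_into UNIV B) f)"
      using symplecticD(1)[OF assms]
      by (simp add: free_act_compose free_act_id surj_iff[THEN iffD1] bij_is_surj)
    then show "f \<in> free_act B ` rel_ideal \<omega> p"
      using sub[OF symplectic_inv[OF assms] f] by blast
  qed (use sub[OF assms] in blast)
qed

definition qclass :: "('l::ab_group_add \<Rightarrow> 'l \<Rightarrow> int) \<Rightarrow> nat \<Rightarrow> ('l fword \<Rightarrow>\<^sub>0 complex) \<Rightarrow> ('l fword \<Rightarrow>\<^sub>0 complex) set" where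
  "qclass \<omega> p f = rel_ideal \<omega> p +>\<^bsub>free_alg\<^esub> f"

lemma carrier_qalg: "carrier (qalg \<omega> p) = range (qclass \<omega> p)"
  by (auto simp: qalg_def FactRing_def A_RCOSETS_def' qclass_def)

lemma qclass_hom: "qclass \<omega> p \<in> Ring.ring_hom free_alg (qalg \<omega> p)"
  unfolding qclass_def qalg_def by (rule ideal.rcos_ring_hom[OF ideal_rel_ideal])

lemma qalg_act_qclass:
  assumes "B \<in> symplectic \<omega>"
  shows "qalg_act B (qclass \<omega> p f) = qclass \<omega> p (free_act B f)"
proof -
  have "qalg_act B (qclass \<omega> p f) = {free_act B i + free_act B f | i. i \<in> rel_ideal \<omega> p}"
    by (auto simp: qalg_act_def qclass_def a_r_coset_def' free_act_add image_iff)
  also have "\<dots> = {i + free_act B f | i. i \<in> free_act B ` rel_ideal \<omega> p}" by blast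
  finally show ?thesis
    unfolding free_act_rel_ideal[OF assms] by (auto simp: qclass_def a_r_coset_def')
qed

lemma qclass_relator:
  assumes "r \<in> relators \<omega> p"
  shows "qclass \<omega> p r = qclass \<omega> p 0"
proof -
  interpret I: ideal "rel_ideal \<omega> p" free_alg by (rule ideal_rel_ideal)
  have "r \<in> rel_ideal \<omega> p"
    using ring.genideal_self[OF ring_free_alg, of "relators \<omega> p"] assms unfolding rel_ideal_def by auto
  moreover have "0 \<in> rel_ideal \<omega> p"
    using additive_subgroup.zero_closed[OF I.additive_subgroup_axioms] by simp
  ultimately show ?thesis
    unfolding qclass_def
    using I.a_coset_join2[OF _ additive_subgroup.a_subgroup[OF I.additive_subgroup_axioms]] by simp
qed

section \<open>Additive characters and planar shears\<close>

lemma psi_add: "psi p (s + t) = psi p s * psi p t"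
  by (simp add: psi_def exp_add[symmetric] algebra_simps add_divide_distrib)

lemma psi_0 [simp]: "psi p 0 = 1"
  by (simp add: psi_def)

lemma psi_nonzero [simp]: "psi p t \<noteq> 0"
  by (simp add: psi_def)

lemma psi_cis: "psi p t = cis (2 * pi * of_int t / of_nat p)"
  by (simp add: psi_def cis_conv_exp algebra_simps)

lemma psi_eq_1_iff:
  assumes "p > 0"
  shows "psi p t = 1 \<longleftrightarrow> int p dvd t"
proof -
  have "psi p t = 1 \<longleftrightarrow> (\<exists>n::int. 2 * pi * of_int t / of_nat p = of_int n * 2 * pi)"
  proof
    assume "psi p t = 1"
    then have "cos (2 * pi * of_int t / of_nat p) = 1" by (simp add: psi_cis complex_eq_iff)
    then show "\<exists>n::int. 2 * pi * of_int t / of_nat p = of_int n * 2 * pi" by (simp add: cos_one_2pi_int)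
  next
    assume "\<exists>n::int. 2 * pi * of_int t / of_nat p = of_int n * 2 * pi"
    then obtain n :: int where "2 * pi * of_int t / of_nat p = 2 * pi * of_int n" by (auto simp: mult_ac)
    then show "psi p t = 1" unfolding psi_cis by (simp only: cis_multiple_2pi Ints_of_int)
  qed
  also have "\<dots> \<longleftrightarrow> (\<exists>n::int. real_of_int t = real_of_int (int p * n))"
    using assms by (intro ex_cong1) (auto simp: field_simps)
  also have "\<dots> \<longleftrightarrow> int p dvd t" unfolding of_int_eq_iff dvd_def by blast
  finally show ?thesis .
qed

lemma psi_uminus: "psi p (- t) = inverse (psi p t)"
  using psi_add[of p t "- t"] by (simp add: field_simps)

lemma psi_cong:
  assumes "p > 0" "int p dvd s - t"
  shows "psi p s = psi p t"
  using psi_add[of p "s - t" t] psi_eq_1_iff[of p "s - t"] assms by simp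

lemma psi_power: "psi p t ^ n = psi p (int n * t)"
  by (induction n) (simp_all add: psi_add algebra_simps)

text \<open>Orthogonality of characters. The averaging arguments in
  \<open>eigenvector_exists\<close> and \<open>extract_state\<close> rest on it.\<close>

lemma psi_sum:
  assumes "p > 0"
  shows "(\<Sum>j<p. psi p (int j * t)) = (if int p dvd t then of_nat p else 0)"
proof (cases "int p dvd t")
  case True
  then have "psi p (int j * t) = 1" for j using assms by (simp add: psi_eq_1_iff)
  then show ?thesis using True by simp
next
  case False
  then have "psi p t \<noteq> 1" using assms by (simp add: psi_eq_1_iff)
  moreover have "psi p t ^ p = 1"
    using assms psi_eq_1_iff[of p "int p * t"] by (simp only: psi_power) simp
  ultimately have "(\<Sum>j<p. psi p t ^ j) = 0"
    by (simp add: geometric_sum)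
  then show ?thesis using False by (simp add: psi_power)
qed

section \<open>The standard symplectic form on the plane\<close>

definition area :: "int \<times> int \<Rightarrow> int \<times> int \<Rightarrow> int" where
  "area x y = fst x * snd y - snd x * fst y"

lemma area_simps [simp]:
  "area (a, b) (c, d) = a * d - b * c" "area (a, b) 0 = 0" "area 0 (a, b) = 0" "area x x = 0"
  by (simp_all add: area_def)

lemma area_uminus [simp]: "area (- x) y = - area x y" "area x (- y) = - area x y"
  by (simp_all add: area_def)

lemma area_commute: "area y x = - area x y"
  by (simp add: area_def)

definition shear_up :: "int \<Rightarrow> int \<times> int \<Rightarrow> int \<times> int" where
  "shear_up n = (\<lambda>(a, b). (a + n * b, b))"

definition shear_low :: "int \<Rightarrow> int \<times> int \<Rightarrow> int \<times> int" where
  "shear_low n = (\<lambda>(a, b). (a, b + n * a))"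

lemma symplecticI:
  assumes "\<And>x. B (C x) = x" "\<And>x. C (B x) = x" "\<And>x y. B (x + y) = B x + B y"
    "\<And>x y. \<omega> (B x) (B y) = \<omega> x y"
  shows "B \<in> symplectic \<omega>"
proof -
  have "bij B" by (rule o_bij[of C]) (simp_all add: fun_eq_iff assms)
  then show ?thesis using assms by (simp add: symplectic_def)
qed

lemma shear_symplectic [simp]: "shear_up n \<in> symplectic area" "shear_low n \<in> symplectic area"
  by (rule symplecticI[of _ "shear_up (- n)"]; auto simp: shear_up_def algebra_simps)
    (rule symplecticI[of _ "shear_low (- n)"]; auto simp: shear_low_def algebra_simps)

lemma uminus_symplectic [simp]: "uminus \<in> symplectic area"
  by (rule symplecticI[of _ uminus]) auto

lemma symplectic_compose:
  assumes "A \<in> symplectic \<omega>" "B \<in> symplectic \<omega>"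
  shows "A \<circ> B \<in> symplectic \<omega>"
  using assms by (auto simp: symplectic_def intro: bij_comp)

lemma symplectic_minus:
  assumes "B \<in> symplectic \<omega>" shows "B (- x) = - B x"
proof -
  have "B 0 + B 0 = B 0" using symplecticD(2)[OF assms, of 0 0] by simp
  then have "B 0 = 0" by simp
  then show ?thesis using symplecticD(2)[OF assms, of x "- x"] by (simp add: eq_neg_iff_add_eq_0 add.commute)
qed

section \<open>Invariant irreducible representations of the Heisenberg relations\<close>

text \<open>The representation in coordinates: \<open>R z\<close> is the operator of the symbol at z
  and h is a half modulo p. Irreducibility is phrased for the symbols alone. In
  \<open>invariant\<close> the operator carries R to its twist, the direction opposite to
  \<open>Gam_invariant\<close>.\<close>

locale weyl_rep = complex_vector_space scale
  for scale :: "complex \<Rightarrow> 'h::ab_group_add \<Rightarrow> 'h" (infixr \<open>*s\<close> 75) +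
  fixes p :: nat and h :: int and R :: "int \<times> int \<Rightarrow> 'h \<Rightarrow> 'h"
  assumes p: "odd p" "p > 1"
    and h: "int p dvd 2 * h - 1"
    and R_linear: "Vector_Spaces.linear scale scale (R z)"
    and R_0: "R 0 v = v"
    and R_add: "R (z + w) v = psi p (h * area z w) *s R z (R w v)"
    and irreducible: "subspace W \<Longrightarrow> (\<And>z v. v \<in> W \<Longrightarrow> R z v \<in> W) \<Longrightarrow> W = {0} \<or> W = UNIV"
    and nontrivial: "\<exists>v::'h. v \<noteq> 0"
    and invariant: "B \<in> symplectic area \<Longrightarrow>
      \<exists>T. Vector_Spaces.linear scale scale T \<and> bij T \<and> (\<forall>z v. T (R z v) = R (B z) (T v))"
begin

section \<open>Schur's lemma and periodicity of the translations\<close>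

lemma p_pos: "p > 0" using p by simp

lemma R_simps: "R z (u + v) = R z u + R z v" "R z (c *s v) = c *s R z v"
  "R z (sum g A) = (\<Sum>i\<in>A. R z (g i))" "R z (u - v) = R z u - R z v" "R z 0 = 0"
proof -
  interpret L: Vector_Spaces.linear scale scale "R z" by (rule R_linear)
  show "R z (u + v) = R z u + R z v" "R z (c *s v) = c *s R z v"
    "R z (sum g A) = (\<Sum>i\<in>A. R z (g i))" "R z (u - v) = R z u - R z v" "R z 0 = 0"
    by (rule L.add L.scale L.sum L.diff L.zero)+
qed

lemma R_mult: "R z (R w v) = psi p (- h * area z w) *s R (z + w) v"
  by (simp add: R_add psi_uminus)

lemma R_commute: "R z (R w v) = psi p (- area z w) *s R w (R z v)"
proof -
  \<comment> \<open>Exchanging z and w changes the sign of \<open>area\<close>, so the two exponents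
    differ by a multiple of 2 h - 1.\<close>
  have "psi p (- h * area z w) = psi p (- area z w + - h * area w z)"
  proof (rule psi_cong[OF p_pos])
    have "- h * area z w - (- area z w + - h * area w z) = - (2 * h - 1) * area z w"
      by (simp add: area_commute[of w z] algebra_simps)
    then show "int p dvd - h * area z w - (- area z w + - h * area w z)"
      using h by (metis dvd_minus_iff dvd_mult2)
  qed
  then show ?thesis
    by (simp only: R_mult[of z w] R_mult[of w z] psi_add scale_scale add.commute[of w z])
qed

lemma span_eq_UNIV:
  assumes "\<And>z s. s \<in> S \<Longrightarrow> R z s \<in> span S" and "s \<in> S" "s \<noteq> 0"
  shows "span S = UNIV"
proof -
  have "span S = {0} \<or> span S = UNIV"
  proof (rule irreducible)
    fix z v assume "v \<in> span S"
    then show "R z v \<in> span S"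
    proof (induction rule: span_induct_alt)
      case (step c x y)
      then show ?case using assms(1) by (simp add: R_simps span_add span_scale)
    qed (simp add: R_simps span_zero)
  qed simp
  then show ?thesis using assms(2,3) span_base by fastforce
qed

lemma commutant_zero_or_bij:
  assumes U: "Vector_Spaces.linear scale scale U" and comm: "\<And>z v. U (R z v) = R z (U v)"
  shows "U = (\<lambda>v. 0) \<or> bij U"
proof (cases "U = (\<lambda>v. 0)")
  case False
  interpret U: Vector_Spaces.linear scale scale U by fact
  have "{v. U v = 0} = {0} \<or> {v. U v = 0} = UNIV"
  proof (rule irreducible)
    show "subspace {v. U v = 0}"
      by (simp add: subspace_def U.add U.scale)
  qed (simp add: comm R_simps)
  moreover have "{v. U v = 0} \<noteq> UNIV" using False by (auto simp: fun_eq_iff)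
  ultimately have ker: "{v. U v = 0} = {0}" by blast
  have "inj U"
  proof (rule injI)
    fix x y assume "U x = U y"
    then have "x - y \<in> {v. U v = 0}" by (simp add: U.diff)
    then show "x = y" unfolding ker by simp
  qed
  have "range U = {0} \<or> range U = UNIV"
  proof (rule irreducible)
    show "subspace (range U)"
      using U.subspace_image[OF subspace_UNIV] .
  qed (auto simp flip: comm)
  moreover have "range U \<noteq> {0}" using False by (auto simp: fun_eq_iff)
  ultimately have "surj U" by blast
  with \<open>inj U\<close> show ?thesis by (simp add: bij_def)
qed simp

text \<open>By irreducibility the orbit of any nonzero vector spans the space, and it is countable
  because the lattice is. This replaces finite dimension, and the commutant being zero or bijective
  supplies the other premise of Dixmier's argument.\<close>

lemma schur:
  assumes T: "Vector_Spaces.linear scale scale T" and comm: "\<And>z v. T (R z v) = R z (T v)"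
  shows "\<exists>c. T = scale c"
proof -
  interpret T: Vector_Spaces.linear scale scale T by fact
  obtain v :: 'h where v: "v \<noteq> 0" using nontrivial by blast
  let ?S = "range (\<lambda>z. R z v)"
  have "span ?S = UNIV"
  proof (rule span_eq_UNIV)
    show "v \<in> ?S" using R_0 by (metis rangeI)
    fix z s assume "s \<in> ?S"
    then obtain w where "s = R w v" by blast
    then show "R z s \<in> span ?S" by (simp only: R_mult) (intro span_scale span_base rangeI)
  qed fact
  moreover have "T = scale c \<or> bij (\<lambda>v. T v - c *s v)" for c
  proof -
    have "Vector_Spaces.linear scale scale (\<lambda>v. T v - c *s v)"
      by unfold_locales (simp_all add: T.add T.scale algebra_simps)
    then have "(\<lambda>v. T v - c *s v) = (\<lambda>v. 0) \<or> bij (\<lambda>v. T v - c *s v)"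
      by (rule commutant_zero_or_bij) (simp add: comm R_simps)
    then show ?thesis by (auto simp: fun_eq_iff)
  qed
  ultimately show ?thesis using scalar_of_countable_span[OF T _ _ _ v, of ?S] by simp
qed

text \<open>\<open>T\<^sup>-\<^sup>1 S\<close> commutes with every \<open>R z\<close>, so Schur's
  lemma applies. As \<beta> is arbitrary, the lemma also covers composites with the parity
  operator.\<close>

lemma intertwiner_unique:
  assumes S: "Vector_Spaces.linear scale scale S" "\<And>z v. S (R z v) = R (\<beta> z) (S v)"
    and T: "Vector_Spaces.linear scale scale T" "bij T" "\<And>z v. T (R z v) = R (\<beta> z) (T v)"
  shows "\<exists>c. \<forall>v. S v = c *s T v"
proof -
  interpret S: Vector_Spaces.linear scale scale S by fact
  interpret T: Vector_Spaces.linear scale scale T by fact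
  define U where "U v = inv_into UNIV T (S v)" for v
  have U: "T (U v) = S v" for v
    unfolding U_def using T(2) by (simp add: bij_is_surj surj_f_inv_f)
  have eqI: "x = y" if "T x = T y" for x y
    using that T(2) by (meson bij_is_inj injD)
  have "Vector_Spaces.linear scale scale U"
    by unfold_locales (rule eqI, simp add: U S.add S.scale T.add T.scale)+
  moreover have "U (R z v) = R z (U v)" for z v
    by (rule eqI) (simp add: U S(2) T(3))
  ultimately obtain c where "U = scale c" using schur by blast
  then have "S v = c *s T v" for v using U[of v] by (simp add: T.scale)
  then show ?thesis by blast
qed

lemma R_axes: "R (a, b) v = psi p (h * (a * b)) *s R (a, 0) (R (0, b) v)"
  using R_add[of "(a, 0)" "(0, b)" v] by simp

lemma R_period_scalar:
  assumes "int p dvd a" "int p dvd b"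
  shows "\<exists>c. c \<noteq> 0 \<and> R (a, b) = scale c"
proof -
  have "R (a, b) (R w v) = R w (R (a, b) v)" for w v
  proof -
    have "int p dvd - area (a, b) w" using assms by (simp add: area_def)
    then have "psi p (- area (a, b) w) = 1" using psi_eq_1_iff[OF p_pos] by blast
    then show ?thesis using R_commute[of "(a, b)" w v] by (simp only: scale_one)
  qed
  then obtain c where c: "R (a, b) = scale c" using schur[OF R_linear] by blast
  obtain v :: 'h where "v \<noteq> 0" using nontrivial by blast
  moreover have "R (- (a, b)) (R (a, b) v) = v" by (simp only: R_mult area_uminus area_simps) (simp add: R_0[unfolded zero_prod_def])
  ultimately have "c \<noteq> 0" unfolding c by (metis scale_zero_left R_simps(5))
  with c show ?thesis by blast
qed

text \<open>
  The translations in \<open>p \<Lambda>\<close> act by a character that is invariant under the shears; as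
  \<open>(n p, p)\<close> is the image of \<open>(0, p)\<close> under a shear, this character is trivial.
\<close>

lemma R_period_horizontal: "R (int p * n, 0) v = v"
proof -
  obtain T where T: "bij T" "Vector_Spaces.linear scale scale T" "\<And>z v. T (R z v) = R (shear_up n z) (T v)"
    using invariant[OF shear_symplectic(1), of n] by blast
  interpret T: Vector_Spaces.linear scale scale T by (rule T(2))
  obtain c where c: "c \<noteq> 0" "R (0, int p) = scale c" using R_period_scalar[of 0 "int p"] by auto
  obtain u where u: "v = T u" using T(1) by (meson bij_is_surj surjD)
  have "c *s T u = T (R (0, int p) u)" by (simp add: c T.scale)
  also have "\<dots> = R (int p * n, int p) (T u)" by (simp add: T(3) shear_up_def mult.commute)
  \<comment> \<open>Splitting along the axes costs a phase whose exponent is divisible by p. Thus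
    the same scalar c stands on both sides and cancels.\<close>
  also have "\<dots> = c *s R (int p * n, 0) (T u)"
    using psi_eq_1_iff[OF p_pos, of "h * (int p * n * int p)"]
    by (subst R_axes) (simp add: c R_simps)
  finally show ?thesis using c(1) u by simp
qed

lemma R_period_vertical: "R (0, int p * n) v = v"
proof -
  obtain T where T: "bij T" "Vector_Spaces.linear scale scale T" "\<And>z v. T (R z v) = R (shear_low n z) (T v)"
    using invariant[OF shear_symplectic(2), of n] by blast
  interpret T: Vector_Spaces.linear scale scale T by (rule T(2))
  obtain c where c: "c \<noteq> 0" "R (int p, 0) = scale c" using R_period_scalar[of "int p" 0] by auto
  obtain u where u: "v = T u" using T(1) by (meson bij_is_surj surjD)
  have "c *s T u = T (R (int p, 0) u)" by (simp add: c T.scale)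
  also have "\<dots> = R (int p, int p * n) (T u)" by (simp add: T(3) shear_low_def mult.commute)
  also have "\<dots> = c *s R (0, int p * n) (T u)"
    using psi_eq_1_iff[OF p_pos, of "h * (int p * (int p * n))"]
    by (subst R_axes) (simp add: c R_simps)
  finally show ?thesis using c(1) u by simp
qed

lemma R_cong:
  assumes "int p dvd fst z - fst w" "int p dvd snd z - snd w"
  shows "R z = R w"
proof
  fix v
  obtain m n where "fst z - fst w = int p * m" "snd z - snd w = int p * n"
    using assms unfolding dvd_def by blast
  then have z: "z = w + (int p * m, int p * n)" by (simp add: prod_eq_iff)
  have "int p dvd area w (int p * m, int p * n)" by (simp add: area_def)
  then have "psi p (h * area w (int p * m, int p * n)) = 1" "psi p (h * (int p * m * (int p * n))) = 1"
    by (simp_all add: psi_eq_1_iff[OF p_pos])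
  then show "R z v = R w v"
    unfolding z by (simp add: R_add R_axes[of "int p * m" "int p * n"] R_period_horizontal R_period_vertical)
qed

lemma shift_sum:
  assumes "\<And>j. g (j + p) = (g j :: 'h)"
  shows "(\<Sum>j<p. g (Suc j)) = (\<Sum>j<p. g j)"
proof -
  have "g 0 + (\<Sum>j<p. g (Suc j)) = (\<Sum>j<Suc p. g j)"
    by (simp only: sum.lessThan_Suc_shift)
  also have "\<dots> = g 0 + (\<Sum>j<p. g j)" using assms[of 0] by (simp add: add.commute)
  finally show ?thesis by simp
qed

text \<open>The Fourier components \<open>w k\<close> of a nonzero vector u under the horizontal
  translations add up to p times u, so one of them is nonzero. Periodicity modulo p makes each
  component an eigenvector.\<close>

lemma eigenvector_exists: "\<exists>k w. w \<noteq> 0 \<and> (\<forall>a. R (a, 0) w = psi p (k * a) *s w)"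
proof -
  obtain u :: 'h where u: "u \<noteq> 0" using nontrivial by blast
  define w where "w k = (\<Sum>j<p. psi p (- (int j * k)) *s R (int j, 0) u)" for k :: int
  have "(\<Sum>l<p. w (int l)) = (\<Sum>j<p. (\<Sum>l<p. psi p (int l * - int j)) *s R (int j, 0) u)"
    unfolding w_def by (subst sum.swap) (simp add: scale_sum_left mult.commute)
  also have "\<dots> = (\<Sum>j<p. if j = 0 then of_nat p *s u else 0)"
  proof (rule sum.cong)
    fix j assume "j \<in> {..<p}"
    then have "int p dvd - int j \<longleftrightarrow> j = 0" using nat_dvd_not_less[of j p] by auto
    then show "(\<Sum>l<p. psi p (int l * - int j)) *s R (int j, 0) u = (if j = 0 then of_nat p *s u else 0)"
      by (simp only: psi_sum[OF p_pos]) (simp add: R_0[unfolded zero_prod_def])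
  qed simp
  also have "\<dots> = of_nat p *s u" using p_pos by simp
  finally have "(\<Sum>l<p. w (int l)) \<noteq> 0" using u p_pos by simp
  then obtain k where k: "w k \<noteq> 0" by (meson sum.neutral)
  have one: "R (1, 0) (w k) = psi p k *s w k"
  proof -
    have "R (1, 0) (w k) = (\<Sum>j<p. psi p (- (int j * k)) *s R (int (Suc j), 0) u)"
      by (simp add: w_def R_simps R_mult)
    also have "\<dots> = psi p k *s (\<Sum>j<p. psi p (- (int (Suc j) * k)) *s R (int (Suc j), 0) u)"
      by (simp add: scale_sum_right psi_add[symmetric] algebra_simps)
    also have "(\<Sum>j<p. psi p (- (int (Suc j) * k)) *s R (int (Suc j), 0) u) = w k"
      unfolding w_def
    proof (rule shift_sum)
      fix j
      have "psi p (- (int (j + p) * k)) = psi p (- (int j * k))"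
        by (rule psi_cong[OF p_pos]) (simp add: algebra_simps)
      moreover have "R (int (j + p), 0) = R (int j, 0)"
        by (rule R_cong) simp_all
      ultimately show "psi p (- (int (j + p) * k)) *s R (int (j + p), 0) u = psi p (- (int j * k)) *s R (int j, 0) u"
        by simp
    qed
    finally show ?thesis .
  qed
  have nat: "R (int n, 0) (w k) = psi p (k * int n) *s w k" for n
  proof (induction n)
    case 0
    then show ?case by (simp add: R_0[unfolded zero_prod_def])
  next
    case (Suc n)
    have "R (int (Suc n), 0) (w k) = R (int n, 0) (R (1, 0) (w k))"
      by (simp add: R_mult add.commute)
    also have "\<dots> = psi p (k * int (Suc n)) *s w k"
      by (simp add: one R_simps Suc.IH psi_add[symmetric] algebra_simps)
    finally show ?case .
  qed
  have "R (a, 0) (w k) = psi p (k * a) *s w k" for a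
  proof -
    obtain n where n: "int n = a mod int p" using p_pos by (metis of_nat_0_less_iff pos_mod_sign zero_le_imp_eq_int)
    have "R (a, 0) = R (int n, 0)"
      by (rule R_cong) (simp_all add: n mod_eq_dvd_iff[symmetric])
    moreover have "psi p (k * a) = psi p (k * int n)"
      by (rule psi_cong[OF p_pos])
        (simp add: n right_diff_distrib[symmetric] mod_eq_dvd_iff[symmetric])
    ultimately show ?thesis by (simp only: nat)
  qed
  with k show ?thesis by blast
qed

section \<open>The basis of horizontal eigenvectors\<close>

definition vacuum :: 'h where
  "vacuum = (SOME v. v \<noteq> 0 \<and> (\<forall>a. R (a, 0) v = v))"

lemma R_vertical_horizontal:
  "R (a, 0) (R (0, b) v) = psi p (- (a * b)) *s R (0, b) (R (a, 0) v)"
  by (subst R_commute) simp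

lemma R_vertical_inverse: "R (0, - b) (R (0, b) v) = v"
  by (simp add: R_mult R_0[unfolded zero_prod_def])

text \<open>A vertical translation by k shifts the horizontal character by -k, which moves the
  eigenvector found above to the trivial character.\<close>

lemma vacuum: "vacuum \<noteq> 0" "R (a, 0) vacuum = vacuum"
proof -
  obtain k w where w: "w \<noteq> 0" "\<And>a. R (a, 0) w = psi p (k * a) *s w"
    using eigenvector_exists by blast
  have "R (0, k) w \<noteq> 0" using w(1) R_vertical_inverse[of k w] R_simps(5) by metis
  moreover have "R (a, 0) (R (0, k) w) = R (0, k) w" for a
    by (simp add: R_vertical_horizontal w(2) R_simps psi_add[symmetric] mult.commute)
  ultimately have "\<exists>v. v \<noteq> 0 \<and> (\<forall>a. R (a, 0) v = v)" by blast
  from someI_ex[OF this] show "vacuum \<noteq> 0" "R (a, 0) vacuum = vacuum"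
    unfolding vacuum_def by blast+
qed

text \<open>The Schroedinger model: horizontal translations act on the states by phases, vertical
  ones shift the index. The index is an integer that matters only modulo p, see
  \<open>state_cong\<close>.\<close>

definition state :: "int \<Rightarrow> 'h" where
  "state k = R (0, k) vacuum"

lemma R_horizontal_state: "R (a, 0) (state k) = psi p (- (a * k)) *s state k"
  by (simp add: state_def R_vertical_horizontal vacuum)

lemma R_vertical_state: "R (0, b) (state k) = state (b + k)"
  by (simp add: state_def R_mult)

lemma state_nonzero: "state k \<noteq> 0"
  using vacuum(1) R_vertical_inverse[of k vacuum] R_simps(5) unfolding state_def by metis

lemma state_cong:
  assumes "int p dvd k - l" shows "state k = state l"
proof -
  have "R (0, k) = R (0, l)" by (rule R_cong) (simp_all add: assms)
  then show ?thesis by (simp add: state_def)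
qed

lemma state_in_span: "state k \<in> span (state ` {0..<int p})"
proof -
  have "state k = state (k mod int p)"
    by (rule state_cong) (simp add: mod_eq_dvd_iff[symmetric])
  then show ?thesis using p_pos by (auto intro!: span_base)
qed

lemma span_states: "span (state ` {0..<int p}) = UNIV"
proof (rule span_eq_UNIV)
  fix z s assume "s \<in> state ` {0..<int p}"
  then obtain k where "s = state k" by blast
  then show "R z s \<in> span (state ` {0..<int p})"
    by (subst surjective_pairing[of z], subst R_axes)
      (simp only: R_vertical_state R_horizontal_state, intro span_scale state_in_span)
next
  show "state 0 \<in> state ` {0..<int p}" using p_pos by auto
qed (rule state_nonzero)

text \<open>Averaging the horizontal translations against a character is p times the projection onto
  its eigenline. Independence of the states and uniqueness of the vacuum up to a scalar both
  follow.\<close>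

lemma extract_state:
  assumes "C \<subseteq> {0..<int p}" "finite C" "k \<in> C"
  shows "(\<Sum>j<p. psi p (int j * k) *s R (int j, 0) (\<Sum>l\<in>C. a l *s state l)) = (of_nat p * a k) *s state k"
proof -
  have "(\<Sum>j<p. psi p (int j * k) *s R (int j, 0) (\<Sum>l\<in>C. a l *s state l)) =
      (\<Sum>j<p. \<Sum>l\<in>C. (psi p (int j * (k - l)) * a l) *s state l)"
    by (simp add: R_simps R_horizontal_state scale_sum_right psi_add psi_uminus algebra_simps diff_conv_add_uminus del: add_uminus_conv_diff)
  also have "\<dots> = (\<Sum>l\<in>C. ((\<Sum>j<p. psi p (int j * (k - l))) * a l) *s state l)"
    by (subst sum.swap) (simp add: scale_sum_left sum_distrib_right)
  also have "\<dots> = (\<Sum>l\<in>C. if l = k then (of_nat p * a k) *s state k else 0)"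
  proof (rule sum.cong)
    fix l assume "l \<in> C"
    have "int p dvd k - l \<longleftrightarrow> l = k"
    proof -
      have "k mod int p = k" "l mod int p = l" using assms \<open>l \<in> C\<close> by auto
      then show ?thesis by (metis mod_eq_dvd_iff)
    qed
    then show "((\<Sum>j<p. psi p (int j * (k - l))) * a l) *s state l = (if l = k then (of_nat p * a k) *s state k else 0)"
      by (simp add: psi_sum[OF p_pos])
  qed simp
  also have "\<dots> = (of_nat p * a k) *s state k" using assms by simp
  finally show ?thesis .
qed

lemma independent_states: "inj_on state {0..<int p}" "independent (state ` {0..<int p})"
proof -
  have "a k = 0" if "finite C" "C \<subseteq> {0..<int p}" "(\<Sum>l\<in>C. a l *s state l) = 0" "k \<in> C" for C a k
  proof -
    have "(of_nat p * a k) *s state k = 0"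
      using extract_state[OF that(2,1,4), of a] that(3) by (simp add: R_simps)
    then show ?thesis using state_nonzero p_pos by simp
  qed
  then show "inj_on state {0..<int p}" "independent (state ` {0..<int p})"
    using independent_family[of "{0..<int p}" state] by blast+
qed

text \<open>The lower bound for the dimension; in \<open>parity_bases\<close> it forces the upper
  bounds for the two parity spaces to be attained.\<close>

lemma card_spanning:
  assumes "finite F" "span F = UNIV"
  shows "p \<le> card F"
  using independent_span_bound[OF assms(1) independent_states(2)] assms(2)
  by (simp add: card_image[OF independent_states(1)])

lemma vacuum_unique:
  assumes "\<And>a. R (a, 0) w = w"
  shows "\<exists>c. w = c *s vacuum"
proof -
  have "w \<in> span (state ` {0..<int p})" using span_states by simp
  then obtain b where "w = (\<Sum>v\<in>state ` {0..<int p}. b v *s v)"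
    using span_finite[of "state ` {0..<int p}"] by auto
  then have w: "w = (\<Sum>l\<in>{0..<int p}. b (state l) *s state l)"
    by (simp add: sum.reindex[OF independent_states(1)])
  have "of_nat p *s w = (\<Sum>j<p. psi p (int j * 0) *s R (int j, 0) w)"
    unfolding scale_sum_left[symmetric] assms by simp
  also have "\<dots> = (of_nat p * b (state 0)) *s state 0"
    using extract_state[of "{0..<int p}" 0 "\<lambda>l. b (state l)"] p_pos unfolding w[symmetric] by simp
  also have "\<dots> = of_nat p *s (b (state 0) *s vacuum)"
    by (simp add: state_def R_0[unfolded zero_prod_def])
  finally have "w = b (state 0) *s vacuum" using p_pos by (simp del: scale_scale)
  then show ?thesis by blast
qed

text \<open>An intertwiner for -1 preserves the line of vectors fixed by the horizontal
  translations, so it can be rescaled to fix the vacuum. Its square then commutes with every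
  \<open>R z\<close>, hence is a scalar, and this scalar is read off on the vacuum.\<close>

lemma parity_exists:
  "\<exists>P. Vector_Spaces.linear scale scale P \<and> (\<forall>z v. P (R z v) = R (- z) (P v)) \<and>
     (\<forall>v. P (P v) = v) \<and> (\<forall>k. P (state k) = state (- k))"
proof -
  obtain T where T: "bij T" "Vector_Spaces.linear scale scale T" "\<And>z v. T (R z v) = R (- z) (T v)"
    using invariant[OF uminus_symplectic] by blast
  interpret T: Vector_Spaces.linear scale scale T by (rule T(2))
  have "R (a, 0) (T vacuum) = T vacuum" for a
    using T(3)[of "(- a, 0)" vacuum] by (simp add: vacuum)
  then obtain c where c: "T vacuum = c *s vacuum" using vacuum_unique by blast
  have "T vacuum \<noteq> 0"
    using vacuum(1) T(1) T.zero by (metis bij_is_inj injD)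
  then have c0: "c \<noteq> 0" using c by auto
  define P where "P v = inverse c *s T v" for v
  have lin: "Vector_Spaces.linear scale scale P"
    by unfold_locales (simp_all add: P_def T.add T.scale scale_right_distrib mult.commute)
  interpret P: Vector_Spaces.linear scale scale P by (rule lin)
  have PR: "P (R z v) = R (- z) (P v)" for z v
    by (simp add: P_def T(3) R_simps)
  have Pvac: "P vacuum = vacuum" using c c0 by (simp add: P_def)
  have Pstate: "P (state k) = state (- k)" for k
    by (simp add: state_def PR Pvac)
  have "Vector_Spaces.linear scale scale (\<lambda>v. P (P v))"
    by unfold_locales (simp_all add: P.add P.scale)
  then obtain d where d: "(\<lambda>v. P (P v)) = scale d"
    using schur[of "\<lambda>v. P (P v)"] PR by auto
  then have "d *s vacuum = 1 *s vacuum" using Pvac by (metis scale_one)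
  then have "d = 1" using vacuum(1) by (simp only: scale_cancel_right) simp
  then have "P (P v) = v" for v using fun_cong[OF d, of v] by simp
  with lin PR Pstate show ?thesis by blast
qed

end

definition cong_mod :: "nat \<Rightarrow> ('a \<Rightarrow> int \<times> int) \<Rightarrow> ('a \<Rightarrow> int \<times> int) \<Rightarrow> bool" where
  "cong_mod p A B \<longleftrightarrow> (\<forall>z. int p dvd fst (A z) - fst (B z) \<and> int p dvd snd (A z) - snd (B z))"

section \<open>Intertwiners, parity spaces and the normalization\<close>

context weyl_rep
begin

text \<open>The coordinate form of \<open>proj_rep\<close>, with conjugation rewritten as
  commutation and tested on symbols only; \<open>proj_rep_eq\<close> shows the agreement.\<close>

definition intertwiners :: "(int \<times> int \<Rightarrow> int \<times> int) \<Rightarrow> ('h \<Rightarrow> 'h) set" where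
  "intertwiners B = {T. Vector_Spaces.linear scale scale T \<and> bij T \<and> (\<forall>z v. T (R z v) = R (B z) (T v))}"

lemma intertwinersD:
  assumes "T \<in> intertwiners B"
  shows "Vector_Spaces.linear scale scale T" "bij T" "T (R z v) = R (B z) (T v)"
  using assms unfolding intertwiners_def by blast+

lemma intertwiners_compose:
  assumes "S \<in> intertwiners A" "T \<in> intertwiners B"
  shows "S \<circ> T \<in> intertwiners (A \<circ> B)"
  using assms by (auto simp: intertwiners_def intro: Vector_Spaces.linear_compose bij_comp simp del: split_paired_All)

lemma intertwiners_scale:
  assumes "T \<in> intertwiners B" "c \<noteq> 0"
  shows "(\<lambda>v. c *s T v) \<in> intertwiners B"
proof -
  note T = intertwinersD[OF assms(1)]
  interpret T: Vector_Spaces.linear scale scale T by (rule T(1))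
  have "Vector_Spaces.linear scale scale (\<lambda>v. c *s T v)"
    by unfold_locales (simp_all add: T.add T.scale scale_right_distrib mult.commute)
  moreover have "bij (\<lambda>v. c *s T v)"
  proof (rule o_bij)
    show "(\<lambda>v. inv_into UNIV T (inverse c *s v)) \<circ> (\<lambda>v. c *s T v) = id"
      using T(2) assms(2) by (simp add: fun_eq_iff bij_is_inj)
    show "(\<lambda>v. c *s T v) \<circ> (\<lambda>v. inv_into UNIV T (inverse c *s v)) = id"
      using T(2) assms(2) by (simp add: fun_eq_iff bij_is_surj surj_f_inv_f)
  qed
  ultimately show ?thesis by (simp add: intertwiners_def T(3) R_simps)
qed

lemma intertwiners_inverse:
  assumes T: "T \<in> intertwiners B" and B: "bij B"
  shows "inv_into UNIV T \<in> intertwiners (inv_into UNIV B)"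
proof -
  note T = intertwinersD[OF T]
  interpret T: Vector_Spaces.linear scale scale T by (rule T(1))
  have i: "T (inv_into UNIV T v) = v" "inv_into UNIV T (T v) = v" for v
    using T(2) by (simp_all add: bij_is_surj surj_f_inv_f bij_is_inj)
  have eqI: "x = y" if "T x = T y" for x y using that i(2) by metis
  have "Vector_Spaces.linear scale scale (inv_into UNIV T)"
    by unfold_locales (rule eqI, simp add: i T.add T.scale)+
  moreover have "inv_into UNIV T (R z v) = R (inv_into UNIV B z) (inv_into UNIV T v)" for z v
    by (rule eqI) (simp add: i T(3) surj_f_inv_f[OF bij_is_surj[OF B]])
  ultimately show ?thesis using T(2) by (simp add: intertwiners_def bij_imp_bij_inv)
qed

lemma intertwiners_scalar:
  assumes "S \<in> intertwiners B" "T \<in> intertwiners B"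
  shows "\<exists>c. c \<noteq> 0 \<and> S = (\<lambda>v. c *s T v)"
proof -
  obtain c where c: "\<And>v. S v = c *s T v"
    using intertwiner_unique[of S B T] intertwinersD[OF assms(1)] intertwinersD[OF assms(2)] by blast
  obtain v :: 'h where "v \<noteq> 0" using nontrivial by blast
  then obtain u where "S u \<noteq> 0"
    using intertwinersD(2)[OF assms(1)] by (metis bij_is_surj surjD)
  then have "c \<noteq> 0" using c by auto
  with c show ?thesis by blast
qed

text \<open>With p = 2 m + 1, folding the states under k and -k bounds the even dimension by m + 1
  and the odd one by m. Together the two parts span a space of dimension at least p, so both bounds
  are equalities; independence of the folded states need not be checked.\<close>

lemma parity_bases:
  obtains P bs cs where
    "Vector_Spaces.linear scale scale P" "\<And>z v. P (R z v) = R (- z) (P v)" "\<And>v. P (P v) = v"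
    "distinct bs" "independent (set bs)" "\<And>v. v \<in> span (set bs) \<longleftrightarrow> P v = v"
    "distinct cs" "independent (set cs)" "\<And>v. v \<in> span (set cs) \<longleftrightarrow> P v = - v"
    "length bs = Suc (length cs)"
proof -
  obtain P where P: "Vector_Spaces.linear scale scale P" "\<And>z v. P (R z v) = R (- z) (P v)"
    "\<And>v. P (P v) = v" "\<And>k. P (state k) = state (- k)"
    using parity_exists by blast
  interpret P: Vector_Spaces.linear scale scale P by (rule P(1))
  obtain m where m: "p = 2 * m + 1" using p(1) by (elim oddE)
  \<comment> \<open>Modulo p every integer is l or -l with l between 0 and m. The values at k and at
    -k are recorded together because both enter the folded vectors.\<close>
  have half: "\<exists>l \<in> {0..int m}. (state k = state l \<and> state (- k) = state (- l)) \<or> (state k = state (- l) \<and> state (- k) = state l)"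
    for k
  proof -
    have mod: "k mod int p \<ge> 0" "k mod int p < int p" using p_pos by simp_all
    show ?thesis
    proof (cases "k mod int p \<le> int m")
      case True
      have "int p dvd k - k mod int p" by (simp add: mod_eq_dvd_iff[symmetric])
      moreover from this have "int p dvd - k - (- (k mod int p))"
        by (metis dvd_minus_iff minus_diff_minus)
      ultimately show ?thesis
        using True mod state_cong by (intro bexI[of _ "k mod int p"]) auto
    next
      case False
      define l where "l = int p - k mod int p"
      have k: "k - (- l) = int p * (k div int p + 1)"
        using mult_div_mod_eq[of "int p" k] by (simp add: l_def algebra_simps)
      then have "int p dvd k - (- l)" by simp
      moreover have "- k - l = int p * - (k div int p + 1)" using k by (simp only: mult_minus_right)
      then have "int p dvd - k - l" by (simp only: dvd_triv_left)
      moreover have "int p = 2 * int m + 1" using m by simp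
      then have "0 \<le> l" "l \<le> int m" using False mod(2) unfolding l_def by linarith+
      then have "l \<in> {0..int m}" by simp
      ultimately show ?thesis using state_cong by (intro bexI[of _ l]) auto
    qed
  qed
  \<comment> \<open>The odd family starts at 1, since l = 0 would contribute the zero vector. This
    is where the dimensions come to differ by one.\<close>
  let ?E = "(\<lambda>l. state l + state (- l)) ` {0..int m}" and ?O = "(\<lambda>l. state l - state (- l)) ` {1..int m}"
  have lin: "Vector_Spaces.linear scale scale (\<lambda>v. v + P v)" "Vector_Spaces.linear scale scale (\<lambda>v. v - P v)"
    by (unfold_locales; simp add: P.add P.scale algebra_simps)+
  have even: "v + P v \<in> span ?E" for v
  proof -
    have "v \<in> span (state ` {0..<int p})" using span_states by simp
    then show ?thesis
    proof (induction rule: span_induct_alt)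
      case (step c x y)
      then obtain k where k: "x = state k" by blast
      obtain l where "l \<in> {0..int m}" "state k + state (- k) = state l + state (- l)"
        using half[of k] by (auto simp: add.commute)
      then have "x + P x \<in> span ?E" by (auto simp: k P(4) intro: span_base)
      then have "c *s (x + P x) + (y + P y) \<in> span ?E" using step span_add[OF span_scale] by blast
      then show ?case by (simp add: P.add P.scale algebra_simps)
    qed (simp add: P.zero span_zero)
  qed
  have odd: "v - P v \<in> span ?O" for v
  proof -
    have "v \<in> span (state ` {0..<int p})" using span_states by simp
    then show ?thesis
    proof (induction rule: span_induct_alt)
      case (step c x y)
      then obtain k where k: "x = state k" by blast
      obtain l where l: "l \<in> {0..int m}" "state k - state (- k) = state l - state (- l) \<or> state k - state (- k) = - (state l - state (- l))"
        using half[of k] by auto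
      have "state l - state (- l) \<in> span ?O"
      proof (cases "l = 0")
        case False
        then show ?thesis using l(1) by (intro span_base) auto
      qed (simp add: span_zero)
      then have "x - P x \<in> span ?O" using l(2) span_neg[of "state l - state (- l)" ?O] by (auto simp: k P(4))
      then have "c *s (x - P x) + (y - P y) \<in> span ?O" using step span_add[OF span_scale] by blast
      then show ?case by (simp add: P.add P.scale algebra_simps)
    qed (simp add: P.zero span_zero)
  qed
  \<comment> \<open>The two halves are the components of v in the eigenspaces of P.\<close>
  have split: "v = (1/2) *s (v + P v) + (1/2) *s (v - P v)" for v
    by (simp add: scale_right_distrib scale_right_diff_distrib flip: scale_left_distrib)
  have subE: "{v. P v = v} \<subseteq> span ?E"
  proof
    fix v assume "v \<in> {v. P v = v}"
    then have "v = (1/2) *s (v + P v)" using split[of v] by simp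
    then show "v \<in> span ?E" using even[of v] span_scale by metis
  qed
  have subO: "{v. P v = - v} \<subseteq> span ?O"
  proof
    fix v assume "v \<in> {v. P v = - v}"
    then have "v = (1/2) *s (v - P v)" using split[of v] by simp
    then show "v \<in> span ?O" using odd[of v] span_scale by metis
  qed
  have spaceE: "subspace {v. P v = v}" by (simp add: subspace_def P.add P.scale)
  have spaceO: "subspace {v. P v = - v}" by (simp add: subspace_def P.add P.scale)
  obtain b where b: "b \<subseteq> {v. P v = v}" "independent b" "{v. P v = v} \<subseteq> span b"
    by (rule basis_exists)
  obtain c where c: "c \<subseteq> {v. P v = - v}" "independent c" "{v. P v = - v} \<subseteq> span c"
    by (rule basis_exists)
  have "card ?E \<le> m + 1" "card ?O \<le> m"
    using card_image_le[of "{0..int m}" "\<lambda>l. state l + state (- l)"]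
      card_image_le[of "{1..int m}" "\<lambda>l. state l - state (- l)"] by simp_all
  moreover have fb: "finite b" "card b \<le> card ?E"
    using independent_span_bound[of ?E b] b(1,2) subE by auto
  moreover have fc: "finite c" "card c \<le> card ?O"
    using independent_span_bound[of ?O c] c(1,2) subO by auto
  moreover have "p \<le> card (b \<union> c)"
  proof (rule card_spanning)
    have "v \<in> span (b \<union> c)" for v
    proof -
      have "P (v + P v) = v + P v" "P (v - P v) = - (v - P v)" by (simp_all add: P.add P.diff P(3) add.commute)
      then have "v + P v \<in> span b" "v - P v \<in> span c" using b(3) c(3) by blast+
      then have "v + P v \<in> span (b \<union> c)" "v - P v \<in> span (b \<union> c)"
        using span_mono[of b "b \<union> c"] span_mono[of c "b \<union> c"] by blast+
      then have "(1/2) *s (v + P v) + (1/2) *s (v - P v) \<in> span (b \<union> c)"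
        by (rule span_add[OF span_scale span_scale])
      then show ?thesis by (simp only: split[symmetric])
    qed
    then show "span (b \<union> c) = UNIV" by blast
  qed (simp add: fb fc)
  moreover have "card (b \<union> c) \<le> card b + card c" by (rule card_Un_le)
  ultimately have card: "card b = Suc (card c)" using m by linarith
  obtain bs where bs: "set bs = b" "distinct bs" using finite_distinct_list[OF fb(1)] by blast
  obtain cs where cs: "set cs = c" "distinct cs" using finite_distinct_list[OF fc(1)] by blast
  have "span b = {v. P v = v}" "span c = {v. P v = - v}"
    using span_minimal[OF b(1) spaceE] b(3) span_minimal[OF c(1) spaceO] c(3) by blast+
  then have "v \<in> span (set bs) \<longleftrightarrow> P v = v" "v \<in> span (set cs) \<longleftrightarrow> P v = - v" for v
    unfolding bs cs by simp_all
  moreover have "independent (set bs)" "independent (set cs)" using b(2) c(2) bs cs by simp_all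
  moreover have "length bs = Suc (length cs)" using card distinct_card[OF bs(2)] distinct_card[OF cs(2)] bs cs by simp
  ultimately show ?thesis using that[OF P(1) P(2) P(3) bs(2) _ _ cs(2)] by blast
qed

lemma normalization_exists:
  obtains \<nu> :: "('h \<Rightarrow> 'h) \<Rightarrow> complex" where
    "\<And>A B S T. A \<in> symplectic area \<Longrightarrow> B \<in> symplectic area \<Longrightarrow> S \<in> intertwiners A \<Longrightarrow> T \<in> intertwiners B \<Longrightarrow>
       \<nu> (S \<circ> T) = \<nu> S * \<nu> T"
    "\<And>B T c. B \<in> symplectic area \<Longrightarrow> T \<in> intertwiners B \<Longrightarrow> c \<noteq> 0 \<Longrightarrow> \<nu> (\<lambda>v. c *s T v) = c * \<nu> T"
    "\<And>B T. B \<in> symplectic area \<Longrightarrow> T \<in> intertwiners B \<Longrightarrow> \<nu> T \<noteq> 0"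
proof -
  obtain P bs cs where P: "Vector_Spaces.linear scale scale P" "\<And>z v. P (R z v) = R (- z) (P v)" "\<And>v. P (P v) = v"
    and bs: "distinct bs" "independent (set bs)" "\<And>v. v \<in> span (set bs) \<longleftrightarrow> P v = v"
    and cs: "distinct cs" "independent (set cs)" "\<And>v. v \<in> span (set cs) \<longleftrightarrow> P v = - v"
    and len: "length bs = Suc (length cs)"
    using parity_bases by blast
  interpret P: Vector_Spaces.linear scale scale P by (rule P(1))
  \<comment> \<open>As -1 is central, \<open>T \<circ> P\<close> and \<open>P \<circ> T\<close>
    intertwine the same map and differ by a scalar c; P being an involution gives c * c = 1. If c
    were -1, T would embed the even part into the odd part, whose dimension is smaller.\<close>
  have commute: "T (P v) = P (T v)" if B: "B \<in> symplectic area" and TB: "T \<in> intertwiners B" for B T v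
  proof -
    note T = intertwinersD[OF TB]
    interpret T: Vector_Spaces.linear scale scale T by (rule T(1))
    have bijP: "bij P" by (rule o_bij[of P]) (simp_all add: fun_eq_iff P(3))
    have "\<exists>c. \<forall>v. (T \<circ> P) v = c *s (P \<circ> T) v"
    proof (rule intertwiner_unique)
      show "Vector_Spaces.linear scale scale (T \<circ> P)" "Vector_Spaces.linear scale scale (P \<circ> T)"
        by (rule Vector_Spaces.linear_compose[OF P(1) T(1)] Vector_Spaces.linear_compose[OF T(1) P(1)])+
      show "(T \<circ> P) (R z v) = R (- B z) ((T \<circ> P) v)" "(P \<circ> T) (R z v) = R (- B z) ((P \<circ> T) v)" for z v
        by (simp_all add: T(3) P(2) symplectic_minus[OF B])
      show "bij (P \<circ> T)" using T(2) bijP by (rule bij_comp)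
    qed
    then obtain c where c: "\<And>v. T (P v) = c *s P (T v)" by auto
    have "T v = (c * c) *s T v" for v
      using c[of "P v"] by (simp add: P(3) c P.scale)
    moreover obtain u where u: "T u \<noteq> 0"
      using nontrivial T(2) by (metis bij_is_surj surjD)
    ultimately have "(c * c) *s T u = 1 *s T u" by simp
    then have "c * c = 1" using u by (simp only: scale_cancel_right) simp
    moreover have "c \<noteq> -1"
    proof
      assume neg: "c = -1"
      have "T ` set bs \<subseteq> span (set cs)"
      proof
        fix w assume "w \<in> T ` set bs"
        then obtain x where x: "x \<in> set bs" "w = T x" by blast
        then have "P x = x" using bs(3) span_base by blast
        then have "T x = - P (T x)" using c[of x] by (simp add: neg)
          then have "P (T x) = - T x" by (metis minus_minus)
          then show "w \<in> span (set cs)" by (simp add: cs(3) x)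
      qed
      moreover have "independent (T ` set bs)"
        using T.independent_injective_image[OF bs(2)] T(2) by (auto intro: bij_is_inj inj_on_subset)
      ultimately have "card (T ` set bs) \<le> card (set cs)"
        using independent_span_bound[of "set cs" "T ` set bs"] by simp
      moreover have "card (T ` set bs) = card (set bs)"
        using T(2) by (intro card_image) (auto intro: bij_is_inj inj_on_subset)
      ultimately show False using bs(1) cs(1) len by (simp add: distinct_card)
    qed
    ultimately have "c = 1" by (simp add: square_eq_1_iff)
    then show ?thesis using c by simp
  qed
  have stable: "T ` set bs \<subseteq> span (set bs)" "T ` set cs \<subseteq> span (set cs)"
    if B: "B \<in> symplectic area" and TB: "T \<in> intertwiners B" for B T
  proof -
    note T = intertwinersD[OF TB]
    interpret T: Vector_Spaces.linear scale scale T by (rule T(1))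
    show "T ` set bs \<subseteq> span (set bs)"
    proof
      fix w assume "w \<in> T ` set bs"
      then obtain x where x: "x \<in> set bs" "w = T x" by blast
      then have "P x = x" using bs(3) span_base by blast
      then show "w \<in> span (set bs)" using commute[OF B TB, of x] by (simp add: bs(3) x)
    qed
    show "T ` set cs \<subseteq> span (set cs)"
    proof
      fix w assume "w \<in> T ` set cs"
      then obtain x where x: "x \<in> set cs" "w = T x" by blast
      then have "P x = - x" using cs(3) span_base by blast
      then show "w \<in> span (set cs)" using commute[OF B TB, of x] by (simp add: cs(3) x T.neg)
    qed
  qed
  let ?b = "\<lambda>T. det (mat_on bs T)" and ?c = "\<lambda>T. det (mat_on cs T)"
  have mult: "?b (S \<circ> T) = ?b S * ?b T" "?c (S \<circ> T) = ?c S * ?c T"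
    if "A \<in> symplectic area" "B \<in> symplectic area" "S \<in> intertwiners A" "T \<in> intertwiners B" for A B S T
    unfolding comp_def
    using det_mat_on_compose[OF bs(2,1) intertwinersD(1)[OF that(3)] stable(1)[OF that(1,3)] stable(1)[OF that(2,4)]]
      det_mat_on_compose[OF cs(2,1) intertwinersD(1)[OF that(3)] stable(2)[OF that(1,3)] stable(2)[OF that(2,4)]]
    by simp_all
  have nz: "?b T \<noteq> 0" "?c T \<noteq> 0" if B: "B \<in> symplectic area" and TB: "T \<in> intertwiners B" for B T
  proof -
    have bijB: "bij B" by (rule symplecticD(1)[OF B])
    have *: "T \<circ> inv_into UNIV T = (\<lambda>v. v)"
      using intertwinersD(2)[OF TB] by (simp add: fun_eq_iff bij_is_surj surj_f_inv_f)
    have "?b T * ?b (inv_into UNIV T) = 1" "?c T * ?c (inv_into UNIV T) = 1"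
      using mult[OF B symplectic_inv[OF B] TB intertwiners_inverse[OF TB bijB]]
      unfolding * by (simp_all add: mat_on_ident bs cs)
    then show "?b T \<noteq> 0" "?c T \<noteq> 0" by auto
  qed
  \<comment> \<open>A scalar c enters the two determinants with exponents
    \<open>Suc (length cs)\<close> and \<open>length cs\<close>, so the quotient keeps exactly one
    factor c.\<close>
  show ?thesis
  proof (rule that[of "\<lambda>T. ?b T / ?c T"])
    fix B T and c :: complex assume "B \<in> symplectic area" "T \<in> intertwiners B" "c \<noteq> 0"
    then show "?b (\<lambda>v. c *s T v) / ?c (\<lambda>v. c *s T v) = c * (?b T / ?c T)"
      by (simp add: det_mat_on_scale[OF bs(2) stable(1)] det_mat_on_scale[OF cs(2) stable(2)] len)
  qed (auto simp: mult nz)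
qed

text \<open>The coordinate form of a linearization that factors through the reduction: the last
  clause stands in for the homomorphism on the finite group, see
  \<open>linearization_iff_lifting\<close>.\<close>

definition lifting :: "((int \<times> int \<Rightarrow> int \<times> int) \<Rightarrow> 'h \<Rightarrow> 'h) \<Rightarrow> bool" where
  "lifting \<rho> \<longleftrightarrow>
     (\<forall>B\<in>symplectic area. \<rho> B \<in> intertwiners B) \<and>
     (\<forall>A\<in>symplectic area. \<forall>B\<in>symplectic area. \<rho> (A \<circ> B) = \<rho> A \<circ> \<rho> B) \<and>
     (\<forall>A\<in>symplectic area. \<forall>B\<in>symplectic area. cong_mod p A B \<longrightarrow> \<rho> A = \<rho> B)"

lemma lifting_exists: "\<exists>\<rho>. lifting \<rho>"
proof -
  obtain \<nu> :: "('h \<Rightarrow> 'h) \<Rightarrow> complex" where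
    mult: "\<And>A B S T. A \<in> symplectic area \<Longrightarrow> B \<in> symplectic area \<Longrightarrow> S \<in> intertwiners A \<Longrightarrow> T \<in> intertwiners B \<Longrightarrow>
       \<nu> (S \<circ> T) = \<nu> S * \<nu> T"
    and scale: "\<And>B T c. B \<in> symplectic area \<Longrightarrow> T \<in> intertwiners B \<Longrightarrow> c \<noteq> 0 \<Longrightarrow> \<nu> (\<lambda>v. c *s T v) = c * \<nu> T"
    and nz: "\<And>B T. B \<in> symplectic area \<Longrightarrow> T \<in> intertwiners B \<Longrightarrow> \<nu> T \<noteq> 0"
    using normalization_exists by blast
  have ex: "\<exists>T. T \<in> intertwiners B \<and> \<nu> T = 1" if B: "B \<in> symplectic area" for B
  proof -
    obtain T where T: "T \<in> intertwiners B" using invariant[OF B] by (auto simp: intertwiners_def)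
    then show ?thesis
      using scale[OF B T, of "inverse (\<nu> T)"] intertwiners_scale[OF T, of "inverse (\<nu> T)"] nz[OF B T]
      by auto
  qed
  have uniq: "S = T" if B: "B \<in> symplectic area" and S: "S \<in> intertwiners B" "\<nu> S = 1" and T: "T \<in> intertwiners B" "\<nu> T = 1" for B S T
  proof -
    obtain c where "c \<noteq> 0" "S = (\<lambda>v. c *s T v)" using intertwiners_scalar[OF S(1) T(1)] by blast
    with scale[OF B T(1), of c] S(2) T(2) show ?thesis by simp
  qed
  define \<rho> where "\<rho> B = (SOME T. T \<in> intertwiners B \<and> \<nu> T = 1)" for B
  have \<rho>: "\<rho> B \<in> intertwiners B" "\<nu> (\<rho> B) = 1" if "B \<in> symplectic area" for B
    using someI_ex[OF ex[OF that]] unfolding \<rho>_def by blast+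
  show ?thesis
    unfolding lifting_def
  proof (intro exI[of _ \<rho>] conjI ballI impI)
    fix A B assume AB: "A \<in> symplectic area" "B \<in> symplectic area"
    have AB': "A \<circ> B \<in> symplectic area" by (rule symplectic_compose[OF AB])
    show "\<rho> (A \<circ> B) = \<rho> A \<circ> \<rho> B"
      by (rule uniq[OF AB' \<rho>(1)[OF AB'] \<rho>(2)[OF AB']])
        (simp_all add: intertwiners_compose \<rho> AB mult[OF AB])
  next
    fix A B assume AB: "A \<in> symplectic area" "B \<in> symplectic area"
      and "cong_mod p A B"
    \<comment> \<open>Congruent maps have the same set of intertwiners, so \<open>SOME\<close>
      selects the same operator for both.\<close>
    then have "R (A z) = R (B z)" for z unfolding cong_mod_def by (intro R_cong) blast+
    then have "intertwiners A = intertwiners B" by (simp add: intertwiners_def)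
    then show "\<rho> A = \<rho> B" by (simp add: \<rho>_def)
  qed (rule \<rho>(1))
qed

end

section \<open>Characters of the modular group\<close>

lemma additive_int:
  fixes g :: "int \<Rightarrow> int"
  assumes "\<And>x y. g (x + y) = g x + g y"
  shows "g x = x * g 1"
proof (induction x rule: int_induct[where k = 0])
  case base
  then show ?case using assms[of 0 0] by simp
next
  case (step1 i)
  then show ?case by (simp add: assms distrib_right)
next
  case (step2 i)
  then show ?case using assms[of "i - 1" 1] by (simp add: left_diff_distrib)
qed

lemma additive_int_pair:
  fixes g :: "int \<times> int \<Rightarrow> int"
  assumes add: "\<And>x y. g (x + y) = g x + g y"
  shows "g (a, b) = a * g (1, 0) + b * g (0, 1)"
proof -
  have "g (a, b) = g (a, 0) + g (0, b)" using add[of "(a, 0)" "(0, b)"] by simp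
  also have "g (a, 0) = a * g (1, 0)"
    by (rule additive_int) (use add[of "(_, 0)" "(_, 0)"] in simp)
  also have "g (0, b) = b * g (0, 1)"
    by (rule additive_int) (use add[of "(0, _)" "(0, _)"] in simp)
  finally show ?thesis .
qed

text \<open>An element of order 4 with square -1. As a product of three shears it is both a tool for
  generation by shears and the origin of the exponent 12.\<close>

definition rotation :: "int \<times> int \<Rightarrow> int \<times> int" where
  "rotation = (\<lambda>(a, b). (b, - a))"

lemma rotation_shears: "rotation = shear_up 1 \<circ> (shear_low (- 1) \<circ> shear_up 1)"
  by (auto simp: rotation_def shear_up_def shear_low_def)

text \<open>Euclid's algorithm on the first column \<open>B (1, 0)\<close>: shears shrink the entry
  of larger absolute value until one entry is 0. Closure of K under composition is enough, because
  the inverse of a shear is a shear.\<close>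

lemma symplectic_generated_by_shears:
  assumes comp: "\<And>A B. A \<in> K \<Longrightarrow> B \<in> K \<Longrightarrow> A \<circ> B \<in> K"
    and up: "\<And>n. shear_up n \<in> K" and low: "\<And>n. shear_low n \<in> K"
  shows "B \<in> symplectic area \<Longrightarrow> B \<in> K"
proof (induction "nat (\<bar>fst (B (1, 0))\<bar> + \<bar>snd (B (1, 0))\<bar>)" arbitrary: B rule: less_induct)
  case less
  have rot: "rotation \<in> K" unfolding rotation_shears by (intro comp up low)
  have "rotation \<circ> rotation = uminus" by (auto simp: rotation_def)
  then have neg: "uminus \<in> K" using comp[OF rot rot] by simp
  have expand: "C (x, y) = (x * fst (C (1, 0)) + y * fst (C (0, 1)), x * snd (C (1, 0)) + y * snd (C (0, 1)))"
    if C: "C \<in> symplectic area" for C x y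
    using additive_int_pair[of "\<lambda>z. fst (C z)" x y] additive_int_pair[of "\<lambda>z. snd (C z)" x y]
      symplecticD(2)[OF C] by (simp add: prod_eq_iff)
  have horizontal: "C \<in> K" if C: "C \<in> symplectic area" "snd (C (1, 0)) = 0" for C
  proof -
    \<comment> \<open>Preservation of \<open>area\<close> is determinant 1; with lower left entry 0
      the diagonal entries are mutually inverse integers, hence equal signs.\<close>
    have det: "fst (C (1, 0)) * snd (C (0, 1)) = 1"
      using symplecticD(3)[OF C(1), of "(1, 0)" "(0, 1)"] C(2) by (simp add: area_def)
    then consider "fst (C (1, 0)) = 1" "snd (C (0, 1)) = 1" | "fst (C (1, 0)) = -1" "snd (C (0, 1)) = -1"
      unfolding zmult_eq_1_iff by blast
    then show ?thesis
    proof cases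
      case 1
      have "C = shear_up (fst (C (0, 1)))"
      proof
        fix z
        show "C z = (shear_up (fst (C (0, 1)))) z"
          using expand[OF C(1), of "fst z" "snd z"] C(2) 1 by (cases z) (simp add: shear_up_def mult.commute)
      qed
      then show ?thesis using up by metis
    next
      case 2
      have "C = uminus \<circ> shear_up (- fst (C (0, 1)))"
      proof
        fix z
        show "C z = (uminus \<circ> shear_up (- fst (C (0, 1)))) z"
          using expand[OF C(1), of "fst z" "snd z"] C(2) 2 by (cases z) (simp add: shear_up_def mult.commute)
      qed
      then show ?thesis using comp[OF neg up] by metis
    qed
  qed
  obtain a c where ac: "B (1, 0) = (a, c)" by (cases "B (1, 0)")
  consider "c = 0" | "a = 0" | "a \<noteq> 0" "c \<noteq> 0" "\<bar>c\<bar> \<le> \<bar>a\<bar>" | "a \<noteq> 0" "c \<noteq> 0" "\<bar>a\<bar> < \<bar>c\<bar>" by linarith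
  then show ?case
  proof cases
    case 1
    then show ?thesis using horizontal[OF less.prems] ac by simp
  next
    case 2
    have "rotation \<in> symplectic area"
      unfolding rotation_shears by (intro symplectic_compose shear_symplectic)
    then have "rotation \<circ> B \<in> K"
      using 2 by (intro horizontal symplectic_compose less.prems) (simp_all add: ac rotation_def)
    \<comment> \<open>The rotation squares to -1, so \<open>uminus \<circ> rotation\<close> undoes
      it.\<close>
    moreover have "B = uminus \<circ> rotation \<circ> (rotation \<circ> B)" by (auto simp: rotation_def fun_eq_iff split: prod.split)
    ultimately show ?thesis using comp[OF comp[OF neg rot]] by metis
  next
    case 3
    \<comment> \<open>The sign is chosen such that s * c has the sign opposite to a, so the shear
      lowers the absolute value of a by that of c. The last case exchanges the roles of a and
      c.\<close>
    define s where "s = - sgn a * sgn c"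
    have "shear_up s \<circ> B \<in> K"
    proof (rule less.hyps)
      have "\<bar>a + s * c\<bar> < \<bar>a\<bar>" using 3 by (cases "a > 0"; cases "c > 0") (auto simp: s_def)
      then show "nat (\<bar>fst ((shear_up s \<circ> B) (1, 0))\<bar> + \<bar>snd ((shear_up s \<circ> B) (1, 0))\<bar>) < nat (\<bar>fst (B (1, 0))\<bar> + \<bar>snd (B (1, 0))\<bar>)"
        by (simp add: ac shear_up_def)
    qed (intro symplectic_compose shear_symplectic less.prems)
    moreover have "B = shear_up (- s) \<circ> (shear_up s \<circ> B)" by (auto simp: shear_up_def fun_eq_iff split: prod.split)
    ultimately show ?thesis using comp[OF up] by metis
  next
    case 4
    define s where "s = - sgn a * sgn c"
    have "shear_low s \<circ> B \<in> K"
    proof (rule less.hyps)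
      have "\<bar>c + s * a\<bar> < \<bar>c\<bar>" using 4 by (cases "a > 0"; cases "c > 0") (auto simp: s_def)
      then show "nat (\<bar>fst ((shear_low s \<circ> B) (1, 0))\<bar> + \<bar>snd ((shear_low s \<circ> B) (1, 0))\<bar>) < nat (\<bar>fst (B (1, 0))\<bar> + \<bar>snd (B (1, 0))\<bar>)"
        by (simp add: ac shear_low_def)
    qed (intro symplectic_compose shear_symplectic less.prems)
    moreover have "B = shear_low (- s) \<circ> (shear_low s \<circ> B)" by (auto simp: shear_low_def fun_eq_iff split: prod.split)
    ultimately show ?thesis using comp[OF low] by metis
  qed
qed

lemma int_character_power:
  fixes u :: "int \<Rightarrow> complex"
  assumes "\<And>m n. u (m + n) = u m * u n" "u 0 = 1"
  shows "u (int n) = u 1 ^ n"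
  by (induction n) (simp_all add: assms)

text \<open>The alternative at -1 is the form in which the value on lower shears becomes known in
  \<open>congruence_character_trivial\<close>.\<close>

lemma int_character_trivial:
  fixes u :: "int \<Rightarrow> complex"
  assumes add: "\<And>m n. u (m + n) = u m * u n" "u 0 = 1" and "u 1 = 1 \<or> u (- 1) = 1"
  shows "u n = 1"
proof -
  have inv: "u (- m) * u m = 1" for m using add(1)[of "- m" m] add(2) by simp
  have "u 1 = 1" using assms(3) inv[of 1] by auto
  then have nat: "u (int m) = 1" for m using int_character_power[OF add] by simp
  show ?thesis
  proof (cases n)
    case (neg m)
    then show ?thesis using inv[of "int (Suc m)"] nat[of "Suc m"] by simp
  qed (simp add: nat)
qed

text \<open>
  The abelianization of \<open>SL\<^sub>2(\<int>)\<close> is cyclic of order 12 and generated by a shear, whose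
  \<open>p\<close>-th power is congruent to the identity.
\<close>

lemma congruence_character_trivial:
  fixes \<chi> :: "(int \<times> int \<Rightarrow> int \<times> int) \<Rightarrow> complex"
  assumes mult: "\<And>A B. A \<in> symplectic area \<Longrightarrow> B \<in> symplectic area \<Longrightarrow> \<chi> (A \<circ> B) = \<chi> A * \<chi> B"
    and one: "\<chi> id = 1"
    and cong: "\<And>A B. A \<in> symplectic area \<Longrightarrow> B \<in> symplectic area \<Longrightarrow> cong_mod p A B \<Longrightarrow> \<chi> A = \<chi> B"
    and p: "coprime p 12"
    and B: "B \<in> symplectic area"
  shows "\<chi> B = 1"
proof -
  let ?u = "\<lambda>n. \<chi> (shear_up n)" and ?l = "\<lambda>n. \<chi> (shear_low n)"
  have id: "id \<in> symplectic area" by (simp add: symplectic_def)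
  have u: "?u (m + n) = ?u m * ?u n" "?u 0 = 1" for m n
  proof -
    have "shear_up (m + n) = shear_up m \<circ> shear_up n" "shear_up 0 = id"
      by (auto simp: shear_up_def algebra_simps)
    then show "?u (m + n) = ?u m * ?u n" "?u 0 = 1" by (simp_all add: mult one)
  qed
  have l: "?l (m + n) = ?l m * ?l n" "?l 0 = 1" for m n
  proof -
    have "shear_low (m + n) = shear_low m \<circ> shear_low n" "shear_low 0 = id"
      by (auto simp: shear_low_def algebra_simps)
    then show "?l (m + n) = ?l m * ?l n" "?l 0 = 1" by (simp_all add: mult one)
  qed
  have S: "rotation \<in> symplectic area"
    unfolding rotation_shears by (intro symplectic_compose shear_symplectic)
  have S2: "rotation \<circ> rotation \<in> symplectic area" by (intro symplectic_compose S)
  have "(rotation \<circ> rotation) \<circ> (rotation \<circ> rotation) = id" by (auto simp: rotation_def)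
  then have S4: "\<chi> rotation ^ 4 = 1"
    using mult[OF S2 S2] mult[OF S S] one by (simp add: power4_eq_xxxx mult.assoc)
  \<comment> \<open>The rotation conjugates the upper shear into the inverse of the lower one, and
    conjugate elements have the same value in a commutative target.\<close>
  have "rotation \<circ> shear_up 1 = shear_low (- 1) \<circ> rotation"
    by (auto simp: rotation_def shear_up_def shear_low_def)
  then have "\<chi> rotation * ?u 1 = ?l (- 1) * \<chi> rotation"
    using mult[OF S shear_symplectic(1)] mult[OF shear_symplectic(2) S] by metis
  moreover have "\<chi> rotation \<noteq> 0" using S4 by auto
  ultimately have lu: "?l (- 1) = ?u 1" by simp
  have "\<chi> rotation = ?u 1 * (?l (- 1) * ?u 1)"
    unfolding rotation_shears
    by (subst mult, (intro symplectic_compose shear_symplectic)+, subst mult) simp_all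
  \<comment> \<open>Three shears of equal value; since the rotation has order 4, the exponent for a
    single shear is 3 * 4 = 12.\<close>
  then have "\<chi> rotation = ?u 1 ^ 3" by (simp add: lu power3_eq_cube)
  then have u12: "?u 1 ^ 12 = 1" using S4 by (simp flip: power_mult)
  have "?u (int p) = ?u 0"
    by (rule cong) (simp_all only: shear_symplectic, auto simp: cong_mod_def shear_up_def)
  then have up: "?u 1 ^ p = 1" using int_character_power[of ?u p] u by simp
  \<comment> \<open>Bezout: a number killed by the exponents p and 12, which are coprime, is killed
    by the exponent 1.\<close>
  obtain x y where xy: "p * x = 12 * y + 1"
    using coprime_bezout_strong[OF p] by auto
  have "?u 1 ^ (p * x) = 1" "?u 1 ^ (12 * y) = 1"
    using up u12 by (simp_all only: power_mult power_one)
  then have "?u 1 = 1" by (simp add: xy power_add)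
  then have shears: "?u n = 1" "?l n = 1" for n
    using int_character_trivial[of ?u n] int_character_trivial[of ?l n] u l lu by auto
  have "B \<in> {B \<in> symplectic area. \<chi> B = 1}"
    by (rule symplectic_generated_by_shears[OF _ _ _ B]) (auto simp: mult shears intro: symplectic_compose)
  then show ?thesis by simp
qed

section \<open>Uniqueness of the lifting\<close>

context weyl_rep
begin

lemma lifting_unique:
  assumes \<rho>: "lifting \<rho>" and \<sigma>: "lifting \<sigma>" and p12: "coprime p 12" and B: "B \<in> symplectic area"
  shows "\<rho> B = \<sigma> B"
proof -
  have \<rho>D: "\<rho> A \<in> intertwiners A" "\<rho> (A \<circ> C) = \<rho> A \<circ> \<rho> C" "cong_mod p A C \<Longrightarrow> \<rho> A = \<rho> C"
    if "A \<in> symplectic area" "C \<in> symplectic area" for A C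
    using \<rho> that unfolding lifting_def by blast+
  have \<sigma>D: "\<sigma> A \<in> intertwiners A" "\<sigma> (A \<circ> C) = \<sigma> A \<circ> \<sigma> C" "cong_mod p A C \<Longrightarrow> \<sigma> A = \<sigma> C"
    if "A \<in> symplectic area" "C \<in> symplectic area" for A C
    using \<sigma> that unfolding lifting_def by blast+
  \<comment> \<open>The quotient of the two liftings. Chosen from the two operators alone, it is the
    same for A and C as soon as both liftings agree there, which yields the congruence condition at
    once.\<close>
  define \<chi> where "\<chi> A = (SOME c. \<forall>v. \<rho> A v = c *s \<sigma> A v)" for A
  have \<chi>: "\<rho> A v = \<chi> A *s \<sigma> A v" if A: "A \<in> symplectic area" for A v
  proof -
    have "\<exists>c. \<forall>v. \<rho> A v = c *s \<sigma> A v"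
      using intertwiners_scalar[OF \<rho>D(1)[OF A A] \<sigma>D(1)[OF A A]] by auto
    from someI_ex[OF this] show ?thesis unfolding \<chi>_def by blast
  qed
  have \<chi>_eq: "\<chi> A = c" if A: "A \<in> symplectic area" and c: "\<And>v. \<rho> A v = c *s \<sigma> A v" for A c
  proof -
    obtain v where v: "\<sigma> A v \<noteq> 0"
      using nontrivial intertwinersD(2)[OF \<sigma>D(1)[OF A A]] by (metis bij_is_surj surjD)
    have "\<chi> A *s \<sigma> A v = c *s \<sigma> A v" using \<chi>[OF A] c by metis
    then show ?thesis using v by simp
  qed
  have id: "id \<in> symplectic area" by (simp add: symplectic_def)
  have "\<chi> B = 1"
  proof (rule congruence_character_trivial[OF _ _ _ p12 B])
    fix A C assume AC: "A \<in> symplectic area" "C \<in> symplectic area"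
    interpret L: Vector_Spaces.linear scale scale "\<sigma> A" by (rule intertwinersD(1)[OF \<sigma>D(1)[OF AC(1) AC(1)]])
    show "\<chi> (A \<circ> C) = \<chi> A * \<chi> C"
      by (rule \<chi>_eq[OF symplectic_compose[OF AC]])
        (simp add: \<rho>D(2)[OF AC] \<sigma>D(2)[OF AC] \<chi>[OF AC(1)] \<chi>[OF AC(2)] L.scale)
    show "\<chi> A = \<chi> C" if "cong_mod p A C"
      unfolding \<chi>_def \<rho>D(3)[OF AC that] \<sigma>D(3)[OF AC that] ..
  next
    \<comment> \<open>A \<open>lifting\<close> is only required to be multiplicative; that it
      preserves the identity follows because an injective idempotent is the identity.\<close>
    have fixes_all: "\<tau> id = id" if "\<tau> id \<in> intertwiners id" "\<tau> (id \<circ> id) = \<tau> id \<circ> \<tau> id" for \<tau>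
    proof
      fix v
      have "\<tau> id (\<tau> id v) = \<tau> id v" using fun_cong[OF that(2), of v] by simp
      then show "\<tau> id v = id v" using intertwinersD(2)[OF that(1)] by (metis bij_is_inj injD id_apply)
    qed
    show "\<chi> id = 1"
      by (rule \<chi>_eq[OF id])
        (simp add: fixes_all[OF \<rho>D(1)[OF id id] \<rho>D(2)[OF id id]] fixes_all[OF \<sigma>D(1)[OF id id] \<sigma>D(2)[OF id id]])
  qed
  then show ?thesis using \<chi>[OF B] by (simp add: fun_eq_iff)
qed

end

section \<open>Representations and lattice coordinates\<close>

lemma representation_action:
  assumes rep: "representation \<omega> p scale \<pi>"
  shows "Vector_Spaces.linear scale scale (\<pi> (qclass \<omega> p f))"
    and "\<pi> (qclass \<omega> p (f + g)) v = \<pi> (qclass \<omega> p f) v + \<pi> (qclass \<omega> p g) v"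
    and "\<pi> (qclass \<omega> p (f * g)) v = \<pi> (qclass \<omega> p f) (\<pi> (qclass \<omega> p g) v)"
    and "\<pi> (qclass \<omega> p 1) v = v"
    and "\<pi> (qclass \<omega> p (free_const c)) v = scale c v"
proof -
  have hom: "\<pi> \<circ> qclass \<omega> p \<in> Ring.ring_hom free_alg (End_ring scale)"
    using rep ring_hom_trans[OF qclass_hom] unfolding representation_def by blast
  show "Vector_Spaces.linear scale scale (\<pi> (qclass \<omega> p f))"
    using ring_hom_closed[OF hom, of f] by (simp add: End_ring_def)
  show "\<pi> (qclass \<omega> p (f + g)) v = \<pi> (qclass \<omega> p f) v + \<pi> (qclass \<omega> p g) v"
    using ring_hom_add[OF hom, of f g] by (simp add: End_ring_def)
  show "\<pi> (qclass \<omega> p (f * g)) v = \<pi> (qclass \<omega> p f) (\<pi> (qclass \<omega> p g) v)"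
    using ring_hom_mult[OF hom, of f g] by (simp add: End_ring_def)
  show "\<pi> (qclass \<omega> p 1) v = v"
    using ring_hom_one[OF hom] by (simp add: End_ring_def)
  show "\<pi> (qclass \<omega> p (free_const c)) v = scale c v"
    using rep by (simp add: representation_def qalg_const_def qclass_def)
qed

lemma representation_relations:
  assumes rep: "representation \<omega> p scale \<pi>"
  shows "\<pi> (qclass \<omega> p (free_sym 0)) v = v"
    and "\<pi> (qclass \<omega> p (free_sym (\<xi> + \<eta>))) v =
      scale (psi p (modular_inverse (int p) 2 * \<omega> \<xi> \<eta>)) (\<pi> (qclass \<omega> p (free_sym \<xi>)) (\<pi> (qclass \<omega> p (free_sym \<eta>)) v))"
proof -
  note act = representation_action[OF rep]
  have zero: "\<pi> (qclass \<omega> p 0) w = 0" for w using act(2)[of 0 0 w] by simp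
  have diff: "\<pi> (qclass \<omega> p f) w = \<pi> (qclass \<omega> p g) w" if "f - g \<in> relators \<omega> p" for f g w
    using act(2)[of "f - g" g w] by (simp add: qclass_relator[OF that] zero)
  show "\<pi> (qclass \<omega> p (free_sym 0)) v = v"
    using diff[of "free_sym 0" 1 v] by (simp add: relators_def act(4))
  let ?c = "psi p (modular_inverse (int p) 2 * \<omega> \<xi> \<eta>)"
  have "free_sym (\<xi> + \<eta>) - free_const ?c * free_sym \<xi> * free_sym \<eta> \<in> relators \<omega> p"
    unfolding relators_def by blast
  from diff[OF this, of v]
  show "\<pi> (qclass \<omega> p (free_sym (\<xi> + \<eta>))) v = scale ?c (\<pi> (qclass \<omega> p (free_sym \<xi>)) (\<pi> (qclass \<omega> p (free_sym \<eta>)) v))"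
    by (simp add: act(3,5))
qed

lemma intertwiner_on_symbols:
  assumes rep: "representation \<omega> p scale \<pi>" and T: "Vector_Spaces.linear scale scale T"
    and sym: "\<And>\<xi> v. T (\<pi> (qclass \<omega> p (free_sym \<xi>)) v) = \<pi> (qclass \<omega> p (free_sym (B \<xi>))) (T v)"
  shows "T (\<pi> (qclass \<omega> p f) v) = \<pi> (qclass \<omega> p (free_act B f)) (T v)"
proof -
  interpret T: Vector_Spaces.linear scale scale T by (rule T)
  note act = representation_action[OF rep]
  show ?thesis
    by (induction f arbitrary: v rule: free_alg_induct)
      (simp_all add: act(2,3,5) T.scale T.add sym free_act_add free_act_mult)
qed

text \<open>Turns irreducibility under the whole algebra into irreducibility under the symbols, the
  form that \<open>weyl_rep\<close> asks for.\<close>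

lemma invariant_on_symbols:
  assumes rep: "representation \<omega> p scale \<pi>" and W: "module.subspace scale W"
    and sym: "\<And>\<xi> v. v \<in> W \<Longrightarrow> \<pi> (qclass \<omega> p (free_sym \<xi>)) v \<in> W"
  shows "v \<in> W \<Longrightarrow> \<pi> (qclass \<omega> p f) v \<in> W"
proof -
  interpret vector_space scale using rep by (simp add: representation_def)
  note act = representation_action[OF rep]
  show "v \<in> W \<Longrightarrow> \<pi> (qclass \<omega> p f) v \<in> W"
    by (induction f arbitrary: v rule: free_alg_induct)
      (simp_all add: act(2,3,5) sym subspace_add[OF W] subspace_scale[OF W])
qed

section \<open>Symplectic coordinates on the lattice\<close>

locale symplectic_coordinates =
  fixes \<omega> :: "'l::ab_group_add \<Rightarrow> 'l \<Rightarrow> int" and J :: "int \<times> int \<Rightarrow> 'l"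
  assumes bij_J: "bij J" and J_add: "J (x + y) = J x + J y" and J_form: "\<omega> (J x) (J y) = area x y"

text \<open>In any basis the form is an integer d times \<open>area\<close>. By unimodularity the
  second coordinate function is pairing with some vector, and its value 1 on the second basis vector
  makes d a divisor of 1. If d is -1, the two basis vectors are exchanged.\<close>

lemma symplectic_coordinates_exist:
  fixes \<omega> :: "'l::ab_group_add \<Rightarrow> 'l \<Rightarrow> int"
  assumes "rank_two_lattice TYPE('l)" "unimodular_symplectic \<omega>"
  shows "\<exists>J. symplectic_coordinates \<omega> J"
proof -
  obtain f :: "int \<times> int \<Rightarrow> 'l" where f: "bij f" "\<And>x y. f (x + y) = f x + f y"
    using assms(1) unfolding rank_two_lattice_def by blast
  note unimodular = assms(2)[unfolded unimodular_symplectic_def]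
  have form: "\<omega> (x + y) z = \<omega> x z + \<omega> y z" "\<omega> x (y + z) = \<omega> x y + \<omega> x z" "\<omega> x x = 0" for x y z
    using unimodular by simp_all
  have unimod: "\<exists>\<xi>. \<phi> = \<omega> \<xi>" if "\<And>x y. \<phi> (x + y) = \<phi> x + \<phi> y" for \<phi> :: "'l \<Rightarrow> int"
    using conjunct2[OF conjunct2[OF conjunct2[OF unimodular]], THEN spec, of \<phi>] that by auto
  define d where "d = \<omega> (f (1, 0)) (f (0, 1))"
  have alt: "\<omega> (f (0, 1)) (f (1, 0)) = - d"
    using form(3)[of "f (1, 0) + f (0, 1)"]
    unfolding form(1,2) form(3)[of "f (1, 0)"] form(3)[of "f (0, 1)"] d_def by simp
  have expand: "\<omega> (f (a, b)) (f (a', b')) = d * area (a, b) (a', b')" for a b a' b'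
  proof -
    have "\<omega> (f (a, b)) (f (a', b')) = a * \<omega> (f (1, 0)) (f (a', b')) + b * \<omega> (f (0, 1)) (f (a', b'))"
      by (rule additive_int_pair[of "\<lambda>x. \<omega> (f x) (f (a', b'))"]) (simp add: f form)
    also have "\<omega> (f (1, 0)) (f (a', b')) = b' * d"
      using additive_int_pair[of "\<lambda>x. \<omega> (f (1, 0)) (f x)" a' b'] by (simp add: f form d_def)
    also have "\<omega> (f (0, 1)) (f (a', b')) = a' * - d"
      using additive_int_pair[of "\<lambda>x. \<omega> (f (0, 1)) (f x)" a' b'] by (simp add: f form alt)
    finally show ?thesis by (simp add: algebra_simps)
  qed
  have inv_add: "inv_into UNIV f (x + y) = inv_into UNIV f x + inv_into UNIV f y" for x y
    using f by (metis bij_inv_eq_iff)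
  obtain \<xi> where \<xi>: "(\<lambda>x. snd (inv_into UNIV f x)) = \<omega> \<xi>"
    using unimod[of "\<lambda>x. snd (inv_into UNIV f x)"] by (auto simp: inv_add)
  obtain a b where ab: "\<xi> = f (a, b)" using bij_is_surj[OF f(1)] by (metis surj_def surj_pair)
  have "d * a = 1"
    using fun_cong[OF \<xi>, of "f (0, 1)"] f(1) by (simp add: ab expand bij_is_inj)
  then consider "d = 1" | "d = -1" unfolding zmult_eq_1_iff by blast
  then show ?thesis
  proof cases
    case 1
    have "symplectic_coordinates \<omega> f"
      by unfold_locales (auto simp: f expand 1)
    then show ?thesis by (intro exI[of _ f])
  next
    case 2
    let ?s = "\<lambda>(a, b). (b, a) :: int \<times> int"
    have "bij ?s" by (rule o_bij[of ?s]) auto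
    then have "symplectic_coordinates \<omega> (f \<circ> ?s)"
      using f expand 2 by unfold_locales (auto simp: bij_comp simp flip: f(2))
    then show ?thesis by (intro exI[of _ "f \<circ> ?s"])
  qed
qed

context symplectic_coordinates
begin

abbreviation J_inv :: "'l \<Rightarrow> int \<times> int" where
  "J_inv \<equiv> inv_into UNIV J"

lemma J_inverse [simp]: "J (J_inv \<xi>) = \<xi>" "J_inv (J z) = z"
  using bij_J by (simp_all add: bij_is_surj surj_f_inv_f bij_is_inj)

lemma J_inv_add: "J_inv (\<xi> + \<eta>) = J_inv \<xi> + J_inv \<eta>"
  by (metis J_add J_inverse)

lemma J_inv_form: "area (J_inv \<xi>) (J_inv \<eta>) = \<omega> \<xi> \<eta>"
  by (metis J_form J_inverse(1))

lemma J_0: "J 0 = 0"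
  using J_add[of 0 0] by simp

definition coord :: "('l \<Rightarrow> 'l) \<Rightarrow> int \<times> int \<Rightarrow> int \<times> int" where
  "coord B = J_inv \<circ> B \<circ> J"

definition uncoord :: "(int \<times> int \<Rightarrow> int \<times> int) \<Rightarrow> 'l \<Rightarrow> 'l" where
  "uncoord A = J \<circ> A \<circ> J_inv"

lemma coord_uncoord [simp]: "coord (uncoord A) = A" "uncoord (coord B) = B"
  by (simp_all add: coord_def uncoord_def fun_eq_iff)

lemma J_coord: "J (coord B z) = B (J z)"
  by (simp add: coord_def)

lemma uncoord_compose: "uncoord (A \<circ> B) = uncoord A \<circ> uncoord B"
  by (simp add: uncoord_def fun_eq_iff)

lemma coord_symplectic: "B \<in> symplectic \<omega> \<Longrightarrow> coord B \<in> symplectic area"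
  unfolding symplectic_def coord_def using bij_J
  by (intro CollectI conjI allI) (simp_all add: J_add J_inv_add J_inv_form J_form bij_comp bij_imp_bij_inv)

lemma uncoord_symplectic: "A \<in> symplectic area \<Longrightarrow> uncoord A \<in> symplectic \<omega>"
  unfolding symplectic_def uncoord_def using bij_J
  by (intro CollectI conjI allI) (simp_all add: J_add J_inv_add J_inv_form J_form bij_comp bij_imp_bij_inv del: split_paired_All)

lemma lattice_pow_J: "J (a, b) [^]\<^bsub>lattice_group\<^esub> n = J (int n * a, int n * b)"
proof -
  interpret monoid "lattice_group :: 'l monoid"
    by (rule monoidI) (simp_all add: lattice_group_def add.assoc)
  show ?thesis
  proof (induction n)
    case 0
    then show ?case by (simp add: J_0[unfolded zero_prod_def]) (simp add: lattice_group_def)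
  next
    case (Suc n)
    have "J (int (Suc n) * a, int (Suc n) * b) = J (int n * a, int n * b) + J (a, b)"
      by (simp add: algebra_simps flip: J_add)
    then show ?case by (simp add: Suc) (simp add: lattice_group_def)
  qed
qed

section \<open>Reduction modulo p in coordinates\<close>

definition multiples :: "nat \<Rightarrow> 'l set" where
  "multiples p = {J (int p * a, int p * b) | a b. True}"

lemma multiples_eq: "(\<lambda>x. x [^]\<^bsub>lattice_group\<^esub> p) ` carrier lattice_group = multiples p"
proof -
  have "(\<lambda>x. x [^]\<^bsub>lattice_group\<^esub> p) ` carrier lattice_group = (\<lambda>x. x [^]\<^bsub>lattice_group\<^esub> p) ` range J"
    using bij_is_surj[OF bij_J] by (simp add: lattice_group_def)
  also have "\<dots> = multiples p"
    by (auto simp: multiples_def lattice_pow_J image_iff) blast+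
  finally show ?thesis .
qed

lemma multiples_iff: "\<xi> \<in> multiples p \<longleftrightarrow> int p dvd fst (J_inv \<xi>) \<and> int p dvd snd (J_inv \<xi>)"
proof
  assume "int p dvd fst (J_inv \<xi>) \<and> int p dvd snd (J_inv \<xi>)"
  then obtain a b where "J_inv \<xi> = (int p * a, int p * b)" by (metis dvdE prod.collapse)
  then show "\<xi> \<in> multiples p" unfolding multiples_def by (metis (mono_tags, lifting) J_inverse(1) mem_Collect_eq)
qed (auto simp: multiples_def)

definition residue :: "nat \<Rightarrow> 'l \<Rightarrow> 'l set" where
  "residue p \<xi> = {\<eta>. \<eta> - \<xi> \<in> multiples p}"

lemma J_inv_diff: "J_inv (\<xi> - \<eta>) = J_inv \<xi> - J_inv \<eta>"
  using J_inv_add[of "\<xi> - \<eta>" \<eta>] by simp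

lemma residue_eq_iff: "residue p \<xi> = residue p \<eta> \<longleftrightarrow> \<xi> - \<eta> \<in> multiples p"
proof
  assume "residue p \<xi> = residue p \<eta>"
  moreover have "\<xi> \<in> residue p \<xi>" by (simp add: residue_def multiples_iff J_inv_diff)
  ultimately show "\<xi> - \<eta> \<in> multiples p" by (simp add: residue_def)
next
  assume *: "\<xi> - \<eta> \<in> multiples p"
  have "\<zeta> - \<xi> \<in> multiples p \<longleftrightarrow> \<zeta> - \<eta> \<in> multiples p" for \<zeta>
  proof -
    have "J_inv (\<zeta> - \<eta>) = J_inv (\<zeta> - \<xi>) + J_inv (\<xi> - \<eta>)" by (simp add: J_inv_diff)
    then show ?thesis using * unfolding multiples_iff by (auto simp: dvd_add_left_iff)
  qed
  then show "residue p \<xi> = residue p \<eta>" by (simp add: residue_def)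
qed

lemma carrier_lattice_mod: "carrier (lattice_mod p) = range (residue p)"
proof -
  have "multiples p #>\<^bsub>lattice_group\<^esub> \<xi> = residue p \<xi>" for \<xi>
  proof -
    have "\<eta> \<in> residue p \<xi> \<longleftrightarrow> (\<exists>h\<in>multiples p. \<eta> = h + \<xi>)" for \<eta>
      by (auto simp: residue_def intro!: bexI[of _ "\<eta> - \<xi>"])
    then show ?thesis by (auto simp: r_coset_def lattice_group_def)
  qed
  then show ?thesis
    unfolding lattice_mod_def multiples_eq FactGroup_def RCOSETS_def
    by (auto simp: lattice_group_def)
qed

text \<open>An additive map commutes with multiplication by p and so preserves the sublattice of
  multiples; the inverse map shows that the target coset is exhausted.\<close>

lemma image_residue:
  assumes B: "B \<in> symplectic \<omega>"
  shows "B ` residue p \<xi> = residue p (B \<xi>)"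
proof -
  have diff: "A \<eta> - A \<zeta> = A (\<eta> - \<zeta>)" if "A \<in> symplectic \<omega>" for A \<eta> \<zeta>
    using symplecticD(2)[OF that, of "\<eta> - \<zeta>" \<zeta>] by simp
  have sub: "A \<eta> \<in> multiples p" if A: "A \<in> symplectic \<omega>" and m: "\<eta> \<in> multiples p" for A \<eta>
  proof -
    obtain a b where \<eta>: "\<eta> = J (int p * a, int p * b)" using m by (auto simp: multiples_def)
    note C = coord_symplectic[OF A]
    have add: "fst (coord A (x + y)) = fst (coord A x) + fst (coord A y)"
      "snd (coord A (x + y)) = snd (coord A x) + snd (coord A y)" for x y
      by (simp_all add: symplecticD(2)[OF C])
    have "coord A (int p * a, int p * b) = (int p * fst (coord A (a, b)), int p * snd (coord A (a, b)))"
      unfolding prod_eq_iff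
        additive_int_pair[of "\<lambda>z. fst (coord A z)", OF add(1), of "int p * a" "int p * b"]
        additive_int_pair[of "\<lambda>z. fst (coord A z)", OF add(1), of a b]
        additive_int_pair[of "\<lambda>z. snd (coord A z)", OF add(2), of "int p * a" "int p * b"]
        additive_int_pair[of "\<lambda>z. snd (coord A z)", OF add(2), of a b]
      by (simp add: algebra_simps)
    then have "A \<eta> = J (int p * fst (coord A (a, b)), int p * snd (coord A (a, b)))"
      unfolding \<eta> J_coord[symmetric] by simp
    then show ?thesis unfolding multiples_def by blast
  qed
  show ?thesis
  proof (intro equalityI subsetI)
    fix \<eta> assume "\<eta> \<in> B ` residue p \<xi>"
    then show "\<eta> \<in> residue p (B \<xi>)"
      using sub[OF B] by (auto simp: residue_def diff[OF B])
  next
    fix \<eta> assume \<eta>: "\<eta> \<in> residue p (B \<xi>)"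
    let ?B' = "inv_into UNIV B"
    have i: "B (?B' \<eta>) = \<eta>" "?B' (B \<xi>) = \<xi>"
      using symplecticD(1)[OF B] by (simp_all add: bij_is_surj surj_f_inv_f bij_is_inj)
    have "?B' \<eta> - \<xi> = ?B' (\<eta> - B \<xi>)" using diff[OF symplectic_inv[OF B], of \<eta> "B \<xi>"] i by simp
    then have "?B' \<eta> \<in> residue p \<xi>"
      using \<eta> sub[OF symplectic_inv[OF B]] by (simp add: residue_def)
    then show "\<eta> \<in> B ` residue p \<xi>" using i(1) by (metis imageI)
  qed
qed

lemma reduction_residue:
  assumes "B \<in> symplectic \<omega>"
  shows "reduction p B (residue p \<xi>) = residue p (B \<xi>)"
  by (simp add: reduction_def carrier_lattice_mod image_residue[OF assms])

lemma reduction_eq_iff: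
  assumes A: "A \<in> symplectic \<omega>" and B: "B \<in> symplectic \<omega>"
  shows "reduction p A = reduction p B \<longleftrightarrow> cong_mod p (coord A) (coord B)"
proof -
  have "reduction p A = reduction p B \<longleftrightarrow> (\<forall>\<xi>. residue p (A \<xi>) = residue p (B \<xi>))"
  proof
    assume "reduction p A = reduction p B"
    then show "\<forall>\<xi>. residue p (A \<xi>) = residue p (B \<xi>)"
      using reduction_residue[OF A] reduction_residue[OF B] by metis
  next
    assume *: "\<forall>\<xi>. residue p (A \<xi>) = residue p (B \<xi>)"
    show "reduction p A = reduction p B"
      unfolding reduction_def carrier_lattice_mod
    proof (rule restrict_ext)
      fix C assume "C \<in> range (residue p)"
      then obtain \<xi> where "C = residue p \<xi>" by blast
      then show "A ` C = B ` C" using * by (simp only: image_residue[OF A] image_residue[OF B])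
    qed
  qed
  also have "\<dots> \<longleftrightarrow> (\<forall>z. residue p (A (J z)) = residue p (B (J z)))"
    using bij_is_surj[OF bij_J] by (metis surjD)
  also have "\<dots> \<longleftrightarrow> cong_mod p (coord A) (coord B)"
    by (simp add: residue_eq_iff multiples_iff cong_mod_def coord_def J_inv_diff)
  finally show ?thesis .
qed

text \<open>Multiplication in \<open>BijGroup\<close> is restricted to \<open>Bij\<close>, so
  membership is needed before a product in \<open>Gam_mod\<close> can be unfolded to a
  composition.\<close>

lemma reduction_Bij:
  assumes B: "B \<in> symplectic \<omega>"
  shows "reduction p B \<in> Bij (carrier (lattice_mod p))"
proof -
  have "bij_betw (\<lambda>C. B ` C) (range (residue p)) (range (residue p))"
    unfolding bij_betw_def
  proof
    show "inj_on (\<lambda>C. B ` C) (range (residue p))"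
      by (intro inj_onI) (simp add: inj_image_eq_iff[OF bij_is_inj[OF symplecticD(1)[OF B]]])
    have "(\<lambda>C. B ` C) ` range (residue p) = residue p ` range B"
      by (simp only: image_image image_residue[OF B])
    then show "(\<lambda>C. B ` C) ` range (residue p) = range (residue p)"
      using symplecticD(1)[OF B] by (simp add: bij_is_surj)
  qed
  then show ?thesis
    by (simp add: Bij_def reduction_def carrier_lattice_mod cong: bij_betw_cong)
qed

lemma mult_Gam_mod:
  assumes A: "A \<in> symplectic \<omega>" and B: "B \<in> symplectic \<omega>"
  shows "reduction p A \<otimes>\<^bsub>Gam_mod \<omega> p\<^esub> reduction p B = reduction p (A \<circ> B)"
proof -
  have "reduction p A \<otimes>\<^bsub>Gam_mod \<omega> p\<^esub> reduction p B = compose (range (residue p)) (reduction p A) (reduction p B)"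
    using reduction_Bij[OF A, of p] reduction_Bij[OF B, of p]
    by (simp add: Gam_mod_def AutoGroup_def BijGroup_def carrier_lattice_mod)
  also have "\<dots> = reduction p (A \<circ> B)"
    unfolding compose_def reduction_def[of p "A \<circ> B"] carrier_lattice_mod
  proof (rule restrict_ext)
    fix C assume "C \<in> range (residue p)"
    then obtain \<xi> where "C = residue p \<xi>" by blast
    then show "reduction p A (reduction p B C) = (A \<circ> B) ` C"
      by (simp only: reduction_residue[OF A] reduction_residue[OF B] image_residue[OF symplectic_compose[OF A B]] comp_apply)
  qed
  finally show ?thesis .
qed

end

lemma mult_Gam:
  assumes "A \<in> symplectic \<omega>" "B \<in> symplectic \<omega>"
  shows "A \<otimes>\<^bsub>Gam \<omega>\<^esub> B = A \<circ> B"
  using assms by (auto simp: Gam_def AutoGroup_def BijGroup_def lattice_group_def symplectic_def Bij_def extensional_def compose_def)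

lemma carrier_Gam_mod: "carrier (Gam_mod \<omega> p) = reduction p ` symplectic \<omega>"
  by (simp add: Gam_mod_def carrier_Gam)

context weyl_rep
begin

lemma lifting_cong:
  assumes "lifting \<sigma>" "\<And>A. A \<in> symplectic area \<Longrightarrow> \<tau> A = \<sigma> A"
  shows "lifting \<tau>"
  using assms by (simp add: lifting_def symplectic_compose)

text \<open>T lies in its own class, with scalar 1, so either alternative puts T among the
  intertwiners. The disjunction lets one lemma serve both directions of
  \<open>linearization_iff_lifting\<close>.\<close>

lemma to_PGL_eq_intertwiners:
  assumes "T \<in> intertwiners A \<or> to_PGL scale T = intertwiners A"
  shows "to_PGL scale T = intertwiners A" "T \<in> intertwiners A"
proof -
  have PGL: "to_PGL scale T = {\<lambda>v. c *s T v | c. c \<noteq> 0}"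
    by (auto simp: to_PGL_def r_coset_def GL_group_def scalars_def comp_def)
  have "T \<in> {\<lambda>v. c *s T v | c. c \<noteq> 0}" by (intro CollectI exI[of _ 1]) simp
  then show T: "T \<in> intertwiners A" using assms PGL by auto
  show "to_PGL scale T = intertwiners A"
    unfolding PGL using intertwiners_scale[OF T] intertwiners_scalar[OF _ T] by blast
qed

end

section \<open>Transfer between the algebra and its coordinate form\<close>

locale qalg_rep = symplectic_coordinates \<omega> J +
  weyl_rep scale p "modular_inverse (int p) 2" "\<lambda>z. \<pi> (qclass \<omega> p (free_sym (J z)))"
  for \<omega> :: "'l::ab_group_add \<Rightarrow> 'l \<Rightarrow> int" and J
    and scale :: "complex \<Rightarrow> 'h::ab_group_add \<Rightarrow> 'h" and p \<pi> +
  assumes rep: "Defs.representation \<omega> p scale \<pi>"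
begin

text \<open>Symbols and constants generate the algebra, so a conjugation rule that holds on the
  symbols holds for every element.\<close>

lemma proj_rep_eq:
  assumes B: "B \<in> symplectic \<omega>"
  shows "proj_rep \<omega> p scale \<pi> B = intertwiners (coord B)"
proof (intro equalityI subsetI)
  fix T assume "T \<in> proj_rep \<omega> p scale \<pi> B"
  then have T: "Vector_Spaces.linear scale scale T" "bij T"
    and conj: "\<And>f. T \<circ> \<pi> (qclass \<omega> p f) \<circ> inv_into UNIV T = \<pi> (qalg_act B (qclass \<omega> p f))"
    by (auto simp: proj_rep_def GL_group_def carrier_qalg)
  have "T (\<pi> (qclass \<omega> p (free_sym (J z))) v) = \<pi> (qclass \<omega> p (free_sym (J (coord B z)))) (T v)" for z v
    using fun_cong[OF conj[of "free_sym (J z)"], of "T v"] T(2)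
    by (simp add: qalg_act_qclass[OF B] J_coord bij_is_inj)
  with T show "T \<in> intertwiners (coord B)" by (simp add: intertwiners_def del: split_paired_All)
next
  fix T assume "T \<in> intertwiners (coord B)"
  note T = intertwinersD[OF this]
  have "T (\<pi> (qclass \<omega> p (free_sym \<xi>)) v) = \<pi> (qclass \<omega> p (free_sym (B \<xi>))) (T v)" for \<xi> v
    using T(3)[of "J_inv \<xi>" v] by (simp add: J_coord)
  then have act: "T (\<pi> (qclass \<omega> p f) v) = \<pi> (qclass \<omega> p (free_act B f)) (T v)" for f v
    by (rule intertwiner_on_symbols[OF rep T(1)])
  have "T \<circ> \<pi> (qclass \<omega> p f) \<circ> inv_into UNIV T = \<pi> (qalg_act B (qclass \<omega> p f))" for f
    using T(2) by (simp add: fun_eq_iff act qalg_act_qclass[OF B] bij_is_surj surj_f_inv_f)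
  then show "T \<in> proj_rep \<omega> p scale \<pi> B"
    using T(1,2) by (auto simp: proj_rep_def GL_group_def carrier_qalg)
qed

text \<open>The carrier of \<open>Gam_mod\<close> is the image of the reduction, so a map on it
  amounts to a map on \<open>Gam\<close> that is constant on fibres. Conversely it is recovered by
  choosing a preimage, and the congruence clause makes the choice immaterial.\<close>

lemma linearization_iff_lifting:
  "linearization \<omega> p scale \<pi> \<rho> \<and>
     (\<exists>\<rho>bar \<in> hom (Gam_mod \<omega> p) (GL_group scale). \<forall>B \<in> carrier (Gam \<omega>). \<rho> B = \<rho>bar (reduction p B)) \<longleftrightarrow>
   \<rho> \<in> extensional (symplectic \<omega>) \<and> lifting (\<lambda>A. \<rho> (uncoord A))"
  (is "?L \<longleftrightarrow> ?R")
proof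
  assume L: ?L
  then obtain \<rho>bar where bar: "\<And>B. B \<in> symplectic \<omega> \<Longrightarrow> \<rho> B = \<rho>bar (reduction p B)"
    unfolding carrier_Gam by blast
  have hom: "\<rho> \<in> hom (Gam \<omega>) (GL_group scale)" and ext: "\<rho> \<in> extensional (symplectic \<omega>)"
    and PGL: "\<And>B. B \<in> symplectic \<omega> \<Longrightarrow> to_PGL scale (\<rho> B) = proj_rep \<omega> p scale \<pi> B"
    using L by (auto simp: linearization_def carrier_Gam)
  have "lifting (\<lambda>A. \<rho> (uncoord A))"
    unfolding lifting_def
  proof (intro conjI ballI impI)
    fix A assume "A \<in> symplectic area"
    then show "\<rho> (uncoord A) \<in> intertwiners A"
      using PGL[OF uncoord_symplectic] proj_rep_eq[OF uncoord_symplectic] to_PGL_eq_intertwiners(2)[OF disjI2] by simp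
  next
    fix A B assume AB: "A \<in> symplectic area" "B \<in> symplectic area"
    note AB' = AB[THEN uncoord_symplectic]
    show "\<rho> (uncoord (A \<circ> B)) = \<rho> (uncoord A) \<circ> \<rho> (uncoord B)"
      using hom_mult[OF hom, of "uncoord A" "uncoord B"] AB'
      by (simp add: carrier_Gam mult_Gam uncoord_compose GL_group_def)
    show "\<rho> (uncoord A) = \<rho> (uncoord B)" if "cong_mod p A B"
      using reduction_eq_iff[OF AB', of p] that bar[OF AB'(1)] bar[OF AB'(2)] by simp
  qed
  with ext show ?R by blast
next
  assume R: ?R
  have inter: "\<rho> B \<in> intertwiners (coord B)" if "B \<in> symplectic \<omega>" for B
    using R coord_symplectic[OF that] unfolding lifting_def by (metis coord_uncoord(2))
  have mult: "\<rho> (A \<circ> B) = \<rho> A \<circ> \<rho> B" if "A \<in> symplectic \<omega>" "B \<in> symplectic \<omega>" for A B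
    using R that[THEN coord_symplectic] unfolding lifting_def by (metis coord_uncoord(2) uncoord_compose)
  have cong: "\<rho> A = \<rho> B" if "A \<in> symplectic \<omega>" "B \<in> symplectic \<omega>" "reduction p A = reduction p B" for A B
    using R that(1,2)[THEN coord_symplectic] reduction_eq_iff[OF that(1,2), of p] that(3)
    unfolding lifting_def by (metis coord_uncoord(2))
  have GL: "\<rho> B \<in> carrier (GL_group scale)" if "B \<in> symplectic \<omega>" for B
    using intertwinersD(1,2)[OF inter[OF that]] by (simp add: GL_group_def)
  have "\<rho> \<in> hom (Gam \<omega>) (GL_group scale)"
    by (rule homI) (simp_all add: carrier_Gam GL mult mult_Gam, simp add: GL_group_def)
  moreover have "to_PGL scale (\<rho> B) = proj_rep \<omega> p scale \<pi> B" if "B \<in> symplectic \<omega>" for B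
    unfolding proj_rep_eq[OF that] by (rule to_PGL_eq_intertwiners(1)) (simp add: inter that)
  ultimately have lin: "linearization \<omega> p scale \<pi> \<rho>"
    using R by (simp add: linearization_def carrier_Gam)
  define \<rho>bar where "\<rho>bar C = \<rho> (SOME B. B \<in> symplectic \<omega> \<and> reduction p B = C)" for C
  have bar: "\<rho>bar (reduction p B) = \<rho> B" if "B \<in> symplectic \<omega>" for B
  proof -
    have "\<exists>A. A \<in> symplectic \<omega> \<and> reduction p A = reduction p B" using that by blast
    from someI_ex[OF this] show ?thesis unfolding \<rho>bar_def by (intro cong that) blast+
  qed
  have "\<rho>bar \<in> hom (Gam_mod \<omega> p) (GL_group scale)"
  proof (rule homI)
    fix C assume "C \<in> carrier (Gam_mod \<omega> p)"
    then show "\<rho>bar C \<in> carrier (GL_group scale)" by (auto simp: carrier_Gam_mod bar GL)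
  next
    fix C D assume "C \<in> carrier (Gam_mod \<omega> p)" "D \<in> carrier (Gam_mod \<omega> p)"
    then obtain A B where AB: "A \<in> symplectic \<omega>" "C = reduction p A" "B \<in> symplectic \<omega>" "D = reduction p B"
      by (auto simp: carrier_Gam_mod)
    then show "\<rho>bar (C \<otimes>\<^bsub>Gam_mod \<omega> p\<^esub> D) = \<rho>bar C \<otimes>\<^bsub>GL_group scale\<^esub> \<rho>bar D"
      by (simp add: mult_Gam_mod bar symplectic_compose mult) (simp add: GL_group_def)
  qed
  then show ?L using lin bar by (auto simp: carrier_Gam intro!: bexI[of _ \<rho>bar])
qed

lemma linearization_unique_exists:
  assumes "coprime p 12"
  shows "\<exists>!\<rho>. linearization \<omega> p scale \<pi> \<rho> \<and>
     (\<exists>\<rho>bar \<in> hom (Gam_mod \<omega> p) (GL_group scale). \<forall>B \<in> carrier (Gam \<omega>). \<rho> B = \<rho>bar (reduction p B))"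
  unfolding linearization_iff_lifting
proof (rule ex_ex1I)
  obtain \<sigma> where \<sigma>: "lifting \<sigma>" using lifting_exists by blast
  let ?\<rho> = "\<lambda>B\<in>symplectic \<omega>. \<sigma> (coord B)"
  have "lifting (\<lambda>A. ?\<rho> (uncoord A))"
    by (rule lifting_cong[OF \<sigma>]) (simp add: uncoord_symplectic)
  then show "\<exists>\<rho>. \<rho> \<in> extensional (symplectic \<omega>) \<and> lifting (\<lambda>A. \<rho> (uncoord A))"
    by (intro exI[of _ ?\<rho>]) simp
next
  fix \<rho> \<sigma>
  assume \<rho>: "\<rho> \<in> extensional (symplectic \<omega>) \<and> lifting (\<lambda>A. \<rho> (uncoord A))"
    and \<sigma>: "\<sigma> \<in> extensional (symplectic \<omega>) \<and> lifting (\<lambda>A. \<sigma> (uncoord A))"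
  show "\<rho> = \<sigma>"
  proof (rule extensionalityI)
    fix B assume "B \<in> symplectic \<omega>"
    then show "\<rho> B = \<sigma> B"
      using lifting_unique[OF conjunct2[OF \<rho>] conjunct2[OF \<sigma>] assms coord_symplectic] by simp
  qed (use \<rho> \<sigma> in blast)+
qed

end

theorem theorem2p2:
  fixes \<omega> :: "'l::ab_group_add \<Rightarrow> 'l \<Rightarrow> int"
    and p :: nat
    and scale :: "complex \<Rightarrow> 'h::ab_group_add \<Rightarrow> 'h"
    and \<pi> :: "('l fword \<Rightarrow>\<^sub>0 complex) set \<Rightarrow> 'h \<Rightarrow> 'h"
  assumes "prime p" and "p \<noteq> 2" and "p \<noteq> 3"
    and "rank_two_lattice TYPE('l)"
    and "unimodular_symplectic \<omega>"
    and "irreducible_rep \<omega> p scale \<pi>"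
    and "Gam_invariant \<omega> p scale \<pi>"
  shows "\<exists>!\<rho>. linearization \<omega> p scale \<pi> \<rho> \<and>
           (\<exists>\<rho>bar \<in> hom (Gam_mod \<omega> p) (GL_group scale).
              \<forall>B \<in> carrier (Gam \<omega>). \<rho> B = \<rho>bar (reduction p B))"
proof -
  have rep: "representation \<omega> p scale \<pi>" using assms(6) by (simp add: irreducible_rep_def)
  obtain J where "symplectic_coordinates \<omega> J"
    using symplectic_coordinates_exist[OF assms(4,5)] by blast
  then interpret symplectic_coordinates \<omega> J .
  interpret vector_space scale using rep by (simp add: representation_def)
  have "p > 2" using prime_ge_2_nat[OF assms(1)] assms(2) by simp
  then have "odd p" using prime_odd_nat[OF assms(1)] by blast
  have "coprime p 2" "coprime p 3"
    by (rule primes_coprime; use assms(1-3) in simp)+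
  \<comment> \<open>Here the exclusion of 2 and 3 takes the form required by the character
    argument.\<close>
  then have "coprime p (2 * 2 * 3)" by (simp only: coprime_mult_right_iff)
  then have p12: "coprime p 12" by simp
  have h: "int p dvd 2 * modular_inverse (int p) 2 - 1"
    using cong_modular_inverse1[of 2 "int p"] \<open>odd p\<close>
    by (simp add: cong_iff_dvd_diff coprime_commute)
  interpret qalg_rep \<omega> J scale p \<pi>
  proof unfold_locales
    show "odd p" by fact
    show "p > 1" using prime_gt_1_nat[OF assms(1)] .
    show "int p dvd 2 * modular_inverse (int p) 2 - 1" by (rule h)
    show "Defs.representation \<omega> p scale \<pi>" by (rule rep)
    fix z
    interpret L: Vector_Spaces.linear scale scale "\<pi> (qclass \<omega> p (free_sym (J z)))"
      by (rule representation_action(1)[OF rep])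
    show "\<pi> (qclass \<omega> p (free_sym (J z))) (u + v) =
        \<pi> (qclass \<omega> p (free_sym (J z))) u + \<pi> (qclass \<omega> p (free_sym (J z))) v" for u v
      by (rule L.add)
    show "\<pi> (qclass \<omega> p (free_sym (J z))) (scale c v) = scale c (\<pi> (qclass \<omega> p (free_sym (J z))) v)" for c v
      by (rule L.scale)
  next
    show "\<pi> (qclass \<omega> p (free_sym (J 0))) v = v" for v
      unfolding J_0 by (rule representation_relations(1)[OF rep])
    show "\<pi> (qclass \<omega> p (free_sym (J (z + w)))) v =
        scale (psi p (modular_inverse (int p) 2 * area z w))
          (\<pi> (qclass \<omega> p (free_sym (J z))) (\<pi> (qclass \<omega> p (free_sym (J w))) v))" for z w v
      unfolding J_add representation_relations(2)[OF rep] J_form ..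
    show "\<exists>v::'h. v \<noteq> 0" using assms(6) by (simp add: irreducible_rep_def)
    show "W = {0} \<or> W = UNIV"
      if W: "subspace W" and inv: "\<And>z v. v \<in> W \<Longrightarrow> \<pi> (qclass \<omega> p (free_sym (J z))) v \<in> W" for W
    proof -
      have "\<pi> (qclass \<omega> p (free_sym \<xi>)) v \<in> W" if "v \<in> W" for \<xi> v
        using inv[OF that, of "J_inv \<xi>"] by simp
      then have "\<forall>f\<in>carrier (qalg \<omega> p). \<pi> f ` W \<subseteq> W"
        using invariant_on_symbols[OF rep W] by (auto simp: carrier_qalg)
      with W show ?thesis using assms(6) by (simp add: irreducible_rep_def)
    qed
    show "\<exists>T. Vector_Spaces.linear scale scale T \<and> bij T \<and>
        (\<forall>z v. T (\<pi> (qclass \<omega> p (free_sym (J z))) v) = \<pi> (qclass \<omega> p (free_sym (J (A z)))) (T v))"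
      if A: "A \<in> symplectic area" for A
    proof -
      note B = uncoord_symplectic[OF A]
      obtain T where T: "Vector_Spaces.linear scale scale T" "bij T"
        and comm: "\<And>f. T \<circ> \<pi> (qalg_act (uncoord A) (qclass \<omega> p f)) = \<pi> (qclass \<omega> p f) \<circ> T"
        using assms(7) B unfolding Gam_invariant_def carrier_Gam rep_iso_def twist_def
        by (auto simp: GL_group_def carrier_qalg)
      interpret T: Vector_Spaces.linear scale scale T by (rule T(1))
      \<comment> \<open>The invariance hypothesis gives an operator from the twisted representation
        to the original one; its inverse runs in the direction that \<open>weyl_rep\<close>
        requires.\<close>
      let ?U = "inv_into UNIV T"
      have i: "T (?U v) = v" "?U (T v) = v" for v
        using T(2) by (simp_all add: bij_is_surj surj_f_inv_f bij_is_inj)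
      have eqI: "x = y" if "T x = T y" for x y using that i(2) by metis
      have comm': "T (\<pi> (qclass \<omega> p (free_sym (J (A z)))) v) = \<pi> (qclass \<omega> p (free_sym (J z))) (T v)" for z v
        using fun_cong[OF comm[of "free_sym (J z)"], of v]
        by (simp add: qalg_act_qclass[OF B]) (simp add: uncoord_def)
      have "Vector_Spaces.linear scale scale ?U"
        by unfold_locales (rule eqI, simp add: i T.add T.scale)+
      moreover have "?U (\<pi> (qclass \<omega> p (free_sym (J z))) v) = \<pi> (qclass \<omega> p (free_sym (J (A z)))) (?U v)" for z v
        by (rule eqI) (simp add: i comm')
      ultimately show ?thesis using bij_imp_bij_inv[OF T(2)] by blast
    qed
  qed
  show ?thesis by (rule linearization_unique_exists[OF p12])
qed

end
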